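(* If $F$ is a planar graph of order at least $2$, then its asymmetric depth satisfies $d(F)\le 5$.
   Context: All graphs are finite, undirected and simple. A partial automorphism of a graph $F$ is an isomorphism between two induced subgraphs of $F$; its rank is the number of vertices in its domain, and it is nontrivial if it moves at least one vertex of its domain. The asymmetric depth of a graph $F$ of order $n\ge 2$ is $d(F)=n-k$, where $k$ is the largest positive integer such that $F$ admits a nontrivial partial automorphism of rank $k$. *)

theory Defs
  imports
    "HOL-Analysis.Analysis"
    "Graph_Theory.Pair_Digraph"
    "Graph_Theory.Digraph_Component"
begin

text \<open>
  Finite simple undirected graphs are instances of the locale \<^locale>\<open>pair_graph\<close>: the arc relation
  is finite, symmetric and irreflexive, so an undirected edge \<open>{u, v}\<close> is represented by the two arcs
  \<open>(u, v)\<close> and \<open>(v, u)\<close>. In the next definition \<open>\<gamma>\<close> is indexed by the set \<open>{u, v}\<close>, so that an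
  undirected edge is drawn only once. The plane is \<^typ>\<open>complex\<close>. The inclusion in the last clause
  says that distinct edges meet at most in common endpoints, since an edge contains no vertices
  other than its own ends.
\<close>

definition plane_drawing ::
    "'a pair_pre_digraph \<Rightarrow> ('a \<Rightarrow> complex) \<Rightarrow> ('a set \<Rightarrow> real \<Rightarrow> complex) \<Rightarrow> bool" where
  "plane_drawing G p \<gamma> \<longleftrightarrow>
     inj_on p (pverts G) \<and>
     (\<forall>(u, v) \<in> parcs G.
        arc (\<gamma> {u, v}) \<and>
        {pathstart (\<gamma> {u, v}), pathfinish (\<gamma> {u, v})} = {p u, p v} \<and>
        path_image (\<gamma> {u, v}) \<inter> p ` pverts G = {p u, p v}) \<and>
     (\<forall>(u, v) \<in> parcs G. \<forall>(x, y) \<in> parcs G.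
        {u, v} \<noteq> {x, y} \<longrightarrow>
        path_image (\<gamma> {u, v}) \<inter> path_image (\<gamma> {x, y}) \<subseteq> p ` pverts G)"

definition planar :: "'a pair_pre_digraph \<Rightarrow> bool" where
  "planar G \<longleftrightarrow> (\<exists>p \<gamma>. plane_drawing G p \<gamma>)"

definition graph_isomorphism ::
    "('a \<Rightarrow> 'b) \<Rightarrow> 'a pair_pre_digraph \<Rightarrow> 'b pair_pre_digraph \<Rightarrow> bool" where
  "graph_isomorphism f G H \<longleftrightarrow>
     bij_betw f (pverts G) (pverts H) \<and>
     (\<forall>u \<in> pverts G. \<forall>v \<in> pverts G. (u, v) \<in> parcs G \<longleftrightarrow> (f u, f v) \<in> parcs H)"

text \<open>
  The map \<open>f\<close> is total as a HOL function, but only its values on the vertices of the induced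
  subgraph \<open>G\<close>, its domain, are relevant.
\<close>

definition partial_automorphism ::
    "'a pair_pre_digraph \<Rightarrow> 'a pair_pre_digraph \<Rightarrow> 'a pair_pre_digraph \<Rightarrow> ('a \<Rightarrow> 'a) \<Rightarrow> bool" where
  "partial_automorphism F G H f \<longleftrightarrow>
     induced_subgraph (with_proj G) (with_proj F) \<and>
     induced_subgraph (with_proj H) (with_proj F) \<and>
     graph_isomorphism f G H"

definition nontrivial_partial_automorphism ::
    "'a pair_pre_digraph \<Rightarrow> 'a pair_pre_digraph \<Rightarrow> 'a pair_pre_digraph \<Rightarrow> ('a \<Rightarrow> 'a) \<Rightarrow> bool" where
  "nontrivial_partial_automorphism F G H f \<longleftrightarrow>
     partial_automorphism F G H f \<and> (\<exists>v \<in> pverts G. f v \<noteq> v)"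

definition nontrivial_ranks :: "'a pair_pre_digraph \<Rightarrow> nat set" where
  "nontrivial_ranks F =
     {k. 0 < k \<and> (\<exists>G H f. nontrivial_partial_automorphism F G H f \<and> card (pverts G) = k)}"

definition asymmetric_depth :: "'a pair_pre_digraph \<Rightarrow> nat" where
  "asymmetric_depth F = card (pverts F) - Max (nontrivial_ranks F)"

text \<open>
  For graphs of order at least \<open>2\<close> the maximum is taken over a finite nonempty set of numbers
  bounded by the order, so neither it nor the truncated subtraction is degenerate.
\<close>

lemma nontrivial_ranks_le:
  assumes "pair_graph F" "k \<in> nontrivial_ranks F"
  shows "k \<le> card (pverts F)"
proof -
  interpret pair_graph F by fact
  from assms(2) obtain G where "induced_subgraph (with_proj G) (with_proj F)" "card (pverts G) = k"
    unfolding nontrivial_ranks_def nontrivial_partial_automorphism_def partial_automorphism_def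
    by blast
  then show ?thesis
    using card_mono[OF pair_finite_verts, of "pverts G"]
    by (auto simp: induced_subgraph_def subgraph_def)
qed

lemma finite_nontrivial_ranks:
  assumes "pair_graph F"
  shows "finite (nontrivial_ranks F)"
  by (rule finite_subset[of _ "{..card (pverts F)}"]) (auto dest: nontrivial_ranks_le[OF assms])

lemma nontrivial_ranks_nonempty:
  assumes "pair_graph F" "card (pverts F) \<ge> 2"
  shows "nontrivial_ranks F \<noteq> {}"
proof -
  interpret pair_graph F by fact
  obtain u v where uv: "u \<in> pverts F" "v \<in> pverts F" "u \<noteq> v"
    using assms(2) pair_finite_verts
    by (metis card_le_Suc0_iff_eq not_less_eq_eq numeral_2_eq_2)
  define S where "S w = \<lparr>pverts = {w}, parcs = {}\<rparr>" for w :: 'a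
  have ind: "induced_subgraph (with_proj (S w)) (with_proj F)" if "w \<in> pverts F" for w
    using that pair_no_loops[of "(w, w)"] wf_digraph_axioms
    by (auto simp: induced_subgraph_def subgraph_def S_def compatible_def wf_digraph_def)
  have "nontrivial_partial_automorphism F (S u) (S v) (\<lambda>_. v)"
    unfolding nontrivial_partial_automorphism_def partial_automorphism_def
      graph_isomorphism_def
    using ind uv by (auto simp: S_def bij_betw_def)
  moreover have "card (pverts (S u)) = 1" by (simp add: S_def)
  ultimately have "1 \<in> nontrivial_ranks F"
    unfolding nontrivial_ranks_def by (metis (mono_tags, lifting) mem_Collect_eq zero_less_one)
  then show ?thesis by blast
qed

end

theory Submission
  imports Defs
begin

text \<open>
  If the neighbourhoods of two distinct vertices \<open>u\<close> and \<open>v\<close> differ in at most five vertices other than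
  \<open>u\<close> and \<open>v\<close>, then deleting these and swapping \<open>u\<close> and \<open>v\<close> shows that the depth is at most \<open>5\<close>. Otherwise
  all pairs satisfy \<open>d u + d v \<ge> 6 + 2 c + 2 a\<close>, where \<open>c\<close> is the number of common neighbours and \<open>a\<close> is
  \<open>1\<close> or \<open>0\<close> according to whether \<open>u\<close> and \<open>v\<close> are adjacent. So vertices of degree at most \<open>5\<close> lie near
  vertices of large degree or on non-triangular faces, which a discharging argument based on Euler's
  formula refutes.

  No rotation system is needed. The faces are the components of the complement of the drawing. That
  an edge on a cycle separates exactly two faces, that the border of a face has no dead ends, and the
  inequality in Euler's formula all follow from the Jordan curve theorem and Janiszewski's theorem.
  Bridges are left out of the drawing and carry charge of their own.
\<close>

text \<open>Without a rotation system the border of a face is a mere set of edges, with neither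
  cyclic order nor multiplicity. This shapes the discharging: charge moves along pairs of a face and
  a border edge, never through corners, and short borders are recognised as triangles or 4-cycles
  from the absence of dead ends alone. It is also the reason for setting bridges apart: a bridge has
  the same face on both sides, and a set would count it once instead of twice. The charge
  \<open>4\<close> of a bridge replaces the two contributions of \<open>2\<close> that its sides
  would make to \<open>2 * n - 6\<close>, so that the total is still
  \<open>6 * (card E - card V - card Phi)\<close>. Since only a lower bound on the number of faces
  is needed, the graph may be disconnected.\<close>

hide_const (open) Digraph_Component.connected

section \<open>Arcs in the plane\<close>

text \<open>The arc \<open>b\<close> inside \<open>T\<close> closes \<open>c\<close> to a Jordan
  curve \<open>J\<close>. The component \<open>f\<close> of \<open>- T\<close> that contains the
  interior of \<open>c\<close> is cut by \<open>J\<close> into its part inside and its part outside;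
  \<open>key\<close> treats both sides at once.\<close>

lemma arc_splits_component:
  fixes c b :: "real \<Rightarrow> complex"
  defines "I \<equiv> path_image c - {pathstart c, pathfinish c}"
  assumes c: "arc c" and b: "arc b" "pathstart b = pathstart c" "pathfinish b = pathfinish c"
    and T: "closed T" "path_image b \<subseteq> T" "path_image c \<inter> T = {pathstart c, pathfinish c}"
  obtains f h h' where "f \<in> components (- T)" "h \<noteq> h'"
    "h \<in> components (- (T \<union> path_image c))" "h' \<in> components (- (T \<union> path_image c))"
    "I \<subseteq> closure h" "I \<subseteq> closure h'" "f = h \<union> h' \<union> I"
proof -
  define J where "J = path_image c \<union> path_image b"
  have loop: "simple_path (c +++ reversepath b)"
    using b c T(2,3) by (intro simple_path_join_loop) (auto simp: arc_reversepath)
  have J: "path_image (c +++ reversepath b) = J"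
    using b by (simp add: path_image_join J_def)
  note jordan = Jordan_inside_outside[OF loop, unfolded J]
  have fin: "pathfinish (c +++ reversepath b) = pathstart (c +++ reversepath b)"
    using b by simp
  have IO: "open (inside J)" "open (outside J)" "connected (inside J)" "connected (outside J)"
      "inside J \<inter> outside J = {}" "inside J \<union> outside J = - J"
      "frontier (inside J) = J" "frontier (outside J) = J"
    using jordan fin by auto
  have "compact J"
    using J loop by (metis compact_simple_path_image)
  have "path_image c \<inter> T \<subseteq> path_image b"
    unfolding T(3) using b(2,3) pathstart_in_path_image[of b] pathfinish_in_path_image[of b] by simp
  then have "J \<inter> T = path_image b"
    using T(2) unfolding J_def by blast
  then have JT: "connected (J \<inter> T)"
    by (simp add: b(1) connected_arc_image)
  have joinT: "J \<union> T = T \<union> path_image c"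
    using T(2) by (auto simp: J_def)
  have "connected I"
    unfolding I_def by (simp add: arc_imp_simple_path c connected_simple_path_endless)
  have "I \<noteq> {}"
    unfolding I_def by (rule nonempty_simple_path_endless[OF arc_imp_simple_path[OF c]])
  then obtain m where m: "m \<in> I" by blast
  have IT: "I \<subseteq> - T" and IJ: "I \<subseteq> J"
    using T(3) by (auto simp: I_def J_def)
  define f where "f = connected_component_set (- T) m"
  have If: "I \<subseteq> f"
    unfolding f_def using \<open>connected I\<close> IT m by (simp add: connected_component_maximal)
  have "open f"
    unfolding f_def using T(1) by (simp add: open_connected_component open_Compl)
  have fT: "f \<inter> T = {}"
    unfolding f_def using connected_component_subset by blast
  have key: "f \<inter> D \<in> components (- (T \<union> path_image c)) \<and> I \<subseteq> closure (f \<inter> D)"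
    if D: "open D" "connected D" "frontier D = J" "D \<inter> J = {}"
      "\<And>C. connected C \<Longrightarrow> C \<inter> D \<noteq> {} \<Longrightarrow> C \<inter> J = {} \<Longrightarrow> C \<subseteq> D" for D
  proof -
    have cl: "I \<subseteq> closure (f \<inter> D)"
    proof
      fix z assume "z \<in> I"
      then have "z \<in> f" "z \<in> closure D"
        using If IJ D(3) by (auto simp: frontier_def)
      then show "z \<in> closure (f \<inter> D)"
        using open_Int_closure_subset[OF \<open>open f\<close>, of D] by blast
    qed
    then have "f \<inter> D \<noteq> {}"
      using m by (metis closure_empty empty_iff subsetD)
    then obtain a where a: "a \<in> f" "a \<in> D"
      by blast
    \<comment> \<open>\<open>J\<close> and \<open>T\<close> meet in the arc \<open>b\<close>, so by Janiszewski's theorem two points separated by neither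
      set are not separated by the union.\<close>
    have 1: "connected_component (- (J \<union> T)) a x" if "x \<in> f" "x \<in> D" for x
    proof (rule Janiszewski[OF \<open>compact J\<close> T(1) JT])
      show "connected_component (- J) a x"
        unfolding connected_component_def using D(2,4) a that by blast
      show "connected_component (- T) a x"
        using a(1) that(1) unfolding f_def
        by (metis connected_component_eq mem_Collect_eq)
    qed
    have 2: "x \<in> f \<inter> D" if "connected_component (- (J \<union> T)) a x" for x
    proof -
      obtain C where C: "connected C" "C \<subseteq> - (J \<union> T)" "a \<in> C" "x \<in> C"
        using \<open>connected_component (- (J \<union> T)) a x\<close> by (auto simp: connected_component_def)
      have "C \<subseteq> connected_component_set (- T) a"
        using C by (intro connected_component_maximal) auto
      moreover have "connected_component_set (- T) a = f"
        using a(1) unfolding f_def by (metis connected_component_eq)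
      moreover have "C \<subseteq> D"
        using C a(2) by (intro D(5)) auto
      ultimately show ?thesis
        using C by auto
    qed
    have "f \<inter> D = connected_component_set (- (J \<union> T)) a"
      using 1 2 by auto
    moreover have "a \<in> - (J \<union> T)"
      using a D(4) fT by auto
    ultimately show ?thesis
      using cl joinT by (auto simp: components_def)
  qed
  have side: "C \<subseteq> D" if "connected C" "C \<inter> D \<noteq> {}" "C \<inter> J = {}" "D = inside J \<or> D = outside J" for C D
  proof (rule ccontr)
    assume "\<not> C \<subseteq> D"
    then have "C \<inter> frontier D \<noteq> {}"
      using that connected_Int_frontier[of C D] by auto
    then show False
      using that IO(7,8) by auto
  qed
  have h: "f \<inter> inside J \<in> components (- (T \<union> path_image c)) \<and> I \<subseteq> closure (f \<inter> inside J)"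
    by (rule key) (use IO side in auto)
  have h': "f \<inter> outside J \<in> components (- (T \<union> path_image c)) \<and> I \<subseteq> closure (f \<inter> outside J)"
    by (rule key) (use IO side in auto)
  show thesis
  proof (rule that)
    show "f \<in> components (- T)"
      unfolding f_def components_def using m IT by auto
    show "f \<inter> inside J \<noteq> f \<inter> outside J"
      using h IO(5) in_components_nonempty by blast
    show "f = f \<inter> inside J \<union> f \<inter> outside J \<union> I"
    proof -
      have "f \<inter> J \<subseteq> I"
        using fT T(2,3) by (auto simp: I_def J_def)
      moreover have "x \<in> inside J \<or> x \<in> outside J \<or> x \<in> J" for x
        using IO(6) by blast
      ultimately show ?thesis
        using If by blast
    qed
  qed (use h h' in auto)
qed

text \<open>An arc alone does not separate the plane, and it meets \<open>T\<close> in a single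
  point, a connected set. By Janiszewski's theorem it therefore separates no two points of the
  component \<open>U\<close> of \<open>- T\<close> around its interior.\<close>

lemma arc_dead_end:
  fixes c :: "real \<Rightarrow> complex"
  assumes c: "arc c" and T: "closed T" "path_image c \<inter> T = {z}"
    and z: "z \<in> {pathstart c, pathfinish c}"
  obtains U where "open U" "path_image c - {pathstart c, pathfinish c} \<subseteq> U"
    "\<And>x y. x \<in> U - path_image c \<Longrightarrow> y \<in> U - path_image c \<Longrightarrow>
       connected_component (- (T \<union> path_image c)) x y"
proof -
  define I where "I = path_image c - {pathstart c, pathfinish c}"
  have "connected I"
    unfolding I_def by (simp add: arc_imp_simple_path c connected_simple_path_endless)
  have "I \<noteq> {}"
    unfolding I_def by (rule nonempty_simple_path_endless[OF arc_imp_simple_path[OF c]])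
  then obtain m where m: "m \<in> I" by blast
  have IT: "I \<subseteq> - T"
    using T(2) z by (auto simp: I_def)
  define U where "U = connected_component_set (- T) m"
  have If: "I \<subseteq> U"
    unfolding U_def using \<open>connected I\<close> IT m by (simp add: connected_component_maximal)
  show thesis
  proof (rule that)
    show "open U"
      unfolding U_def using T(1) by (simp add: open_connected_component open_Compl)
    show "path_image c - {pathstart c, pathfinish c} \<subseteq> U"
      using If by (simp add: I_def)
    fix x y assume xy: "x \<in> U - path_image c" "y \<in> U - path_image c"
    have "connected_component (- (path_image c \<union> T)) x y"
    proof (rule Janiszewski)
      show "compact (path_image c)" by (simp add: c compact_arc_image)
      show "connected (path_image c \<inter> T)" using T by simp
      show "connected_component (- path_image c) x y"
        unfolding connected_component_def
        using connected_arc_complement[OF c] xy by (intro exI[of _ "- path_image c"]) auto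
      show "connected_component (- T) x y"
        using xy unfolding U_def by (metis DiffD1 connected_component_eq mem_Collect_eq)
    qed (use T in auto)
    then show "connected_component (- (T \<union> path_image c)) x y"
      by (simp add: Un_commute)
  qed
qed

text \<open>A disc stays connected when a point is removed. Its image under the inverse
  parametrisation, a subset of \<open>{0..1}\<close>, does not once a value between two others is
  removed.\<close>

lemma arc_no_open_subset:
  fixes c :: "real \<Rightarrow> complex"
  assumes c: "arc c" and U: "open U" "U \<subseteq> path_image c"
  shows "U = {}"
proof (rule ccontr)
  assume "U \<noteq> {}"
  then obtain z r where z: "r > 0" "ball z r \<subseteq> U"
    using U(1) open_contains_ball by blast
  define B where "B = ball z r"
  have Bc: "B \<subseteq> path_image c"
    using z(2) U(2) by (auto simp: B_def)
  obtain k where k: "homeomorphism {0..1} (path_image c) c k"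
    using homeomorphism_arc[OF c] by blast
  have inj: "inj_on k B"
    using k Bc by (metis homeomorphism_apply2 inj_on_def subsetD)
  have "infinite B"
    using uncountable_ball[OF z(1)] countable_finite unfolding B_def by blast
  then obtain S where S: "S \<subseteq> B" "card S = 3" "finite S"
    by (metis infinite_arbitrarily_large)
  have "card (k ` S) = 3"
    using S inj by (metis card_image inj_on_subset)
  then obtain a b d where abd: "k ` S = {a, b, d}" "a < b" "b < d"
    by (auto simp: card_3_iff) (metis insert_commute linorder_neqE_linordered_idom)
  then have "a \<in> k ` B" "b \<in> k ` B" "d \<in> k ` B"
    using S(1) by blast+
  then obtain x y w where xyw: "x \<in> B" "y \<in> B" "w \<in> B" "k x = a" "k y = b" "k w = d"
    by blast
  have "connected (B - {y})"
    using connected_open_diff_countable[of B "{y}"] by (simp add: B_def)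
  moreover have "continuous_on (B - {y}) k"
    using k Bc by (meson Diff_subset continuous_on_subset homeomorphism_cont2)
  ultimately have "connected (k ` (B - {y}))"
    using connected_continuous_image by blast
  moreover have "a \<in> k ` (B - {y})" "d \<in> k ` (B - {y})"
    using xyw abd by auto
  ultimately have "b \<in> k ` (B - {y})"
    using abd by (meson connectedD_interval less_imp_le)
  then show False
    using xyw inj by (auto simp: inj_on_def)
qed

section \<open>Components of a graph\<close>

definition linked :: "'a set set \<Rightarrow> ('a \<times> 'a) set" where
  "linked X = {(x, y). {x, y} \<in> X}\<^sup>*"

text \<open>The number of components: \<open>linked\<close> is reflexive on the whole type, so a
  vertex of \<open>V\<close> on no edge of \<open>X\<close> forms a class of its own.\<close>

definition class_count :: "'a set \<Rightarrow> 'a set set \<Rightarrow> nat" where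
  "class_count V X = card ((\<lambda>u. linked X `` {u}) ` V)"

lemma linked_sym: "(u, v) \<in> linked X \<Longrightarrow> (v, u) \<in> linked X"
proof -
  have "sym (linked X)"
    unfolding linked_def by (rule sym_rtrancl) (auto simp: sym_def insert_commute)
  then show "(u, v) \<in> linked X \<Longrightarrow> (v, u) \<in> linked X"
    by (rule symD)
qed

lemma linked_trans: "(u, v) \<in> linked X \<Longrightarrow> (v, w) \<in> linked X \<Longrightarrow> (u, w) \<in> linked X"
  unfolding linked_def by (rule rtrancl_trans)

lemma linked_refl: "(u, u) \<in> linked X"
  unfolding linked_def by simp

lemma linked_mono: "X \<subseteq> Y \<Longrightarrow> linked X \<subseteq> linked Y"
  unfolding linked_def by (rule rtrancl_mono) auto

lemma linked_class_eq: "(u, v) \<in> linked X \<longleftrightarrow> linked X `` {u} = linked X `` {v}"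
proof
  assume uv: "(u, v) \<in> linked X"
  have "(u, x) \<in> linked X \<longleftrightarrow> (v, x) \<in> linked X" for x
    using linked_trans[OF uv, of x] linked_trans[OF linked_sym[OF uv], of x] by blast
  then show "linked X `` {u} = linked X `` {v}"
    by auto
next
  assume "linked X `` {u} = linked X `` {v}"
  then show "(u, v) \<in> linked X"
    using linked_refl[of v X] by blast
qed

text \<open>A walk can be shortened until it uses the new edge at most once, in one of the two
  directions.\<close>

lemma linked_insert:
  "(x, y) \<in> linked (insert {u, v} X) \<longleftrightarrow>
     (x, y) \<in> linked X \<or> (x, u) \<in> linked X \<and> (v, y) \<in> linked X \<or> (x, v) \<in> linked X \<and> (u, y) \<in> linked X"
    (is "?L \<longleftrightarrow> ?R")
proof
  assume ?L
  then show ?R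
    unfolding linked_def
  proof (induction rule: rtrancl_induct)
    case base
    then show ?case by simp
  next
    case (step y z)
    consider "{y, z} \<in> X" | "y = u" "z = v" | "y = v" "z = u"
      using step(2) by (auto simp: doubleton_eq_iff)
    then show ?case
    proof cases
      case 1
      then have yz: "(y, z) \<in> {(x, y). {x, y} \<in> X}"
        by simp
      show ?thesis
        using step.IH rtrancl_into_rtrancl[OF _ yz] by blast
    next
      case 2
      then show ?thesis
        using step.IH by blast
    next
      case 3
      then show ?thesis
        using step.IH by blast
    qed
  qed
next
  let ?Y = "insert {u, v} X"
  have mono: "a \<in> linked X \<Longrightarrow> a \<in> linked ?Y" for a
    using linked_mono[of X ?Y] by blast
  have uv: "(u, v) \<in> linked ?Y"
    unfolding linked_def by blast
  have mid: "(a, b) \<in> linked X \<Longrightarrow> (b, c) \<in> linked ?Y \<Longrightarrow> (c, d) \<in> linked X \<Longrightarrow> (a, d) \<in> linked ?Y"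
    for a b c d
    by (rule linked_trans[OF mono linked_trans[OF _ mono]])
  assume ?R
  then show ?L
    using mono mid[OF _ uv] mid[OF _ linked_sym[OF uv]] by blast
qed

lemma class_count_insert_linked:
  assumes "(u, v) \<in> linked X"
  shows "class_count V (insert {u, v} X) = class_count V X"
proof -
  have "(x, y) \<in> linked (insert {u, v} X) \<longleftrightarrow> (x, y) \<in> linked X" for x y
    unfolding linked_insert using assms linked_trans[of x u X] linked_trans[of x v X]
      linked_trans[of u v X y] linked_trans[of v u X y] linked_sym[of u v X] by blast
  then have "linked (insert {u, v} X) = linked X"
    by auto
  then show ?thesis by (simp add: class_count_def)
qed

text \<open>The classes of \<open>u\<close> and \<open>v\<close> merge into their union, and all
  other classes remain as they are.\<close>

lemma class_count_insert_unlinked: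
  assumes V: "finite V" "u \<in> V" "v \<in> V" and "(u, v) \<notin> linked X"
  shows "class_count V (insert {u, v} X) + 1 \<le> class_count V X"
proof -
  let ?c = "\<lambda>w. linked X `` {w}" and ?d = "\<lambda>w. linked (insert {u, v} X) `` {w}"
  have uv: "?c u \<noteq> ?c v"
    using assms(4) linked_class_eq by metis
  have sub: "?d ` V \<subseteq> insert (?c u \<union> ?c v) (?c ` V - {?c u, ?c v})"
  proof
    fix A assume "A \<in> ?d ` V"
    then obtain w where w: "w \<in> V" "A = ?d w" by blast
    consider "(w, u) \<in> linked X" | "(w, v) \<in> linked X" | "(w, u) \<notin> linked X" "(w, v) \<notin> linked X"
      by blast
    then show "A \<in> insert (?c u \<union> ?c v) (?c ` V - {?c u, ?c v})"
    proof cases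
      case 1
      then have "?c w = ?c u"
        using linked_class_eq by metis
      then have "(w, x) \<in> linked X \<longleftrightarrow> (u, x) \<in> linked X" for x
        by (simp add: set_eq_iff)
      then have "(w, x) \<in> linked (insert {u, v} X) \<longleftrightarrow> (u, x) \<in> linked X \<or> (v, x) \<in> linked X" for x
        unfolding linked_insert using assms(4) linked_sym[of v u X] linked_refl[of u X] by blast
      then have "?d w = ?c u \<union> ?c v"
        by blast
      then show ?thesis using w by blast
    next
      case 2
      then have "?c w = ?c v"
        using linked_class_eq by metis
      then have "(w, x) \<in> linked X \<longleftrightarrow> (v, x) \<in> linked X" for x
        by (simp add: set_eq_iff)
      then have "(w, x) \<in> linked (insert {u, v} X) \<longleftrightarrow> (u, x) \<in> linked X \<or> (v, x) \<in> linked X" for x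
        unfolding linked_insert using assms(4) linked_sym[of v u X] linked_refl[of v X] by blast
      then have "?d w = ?c u \<union> ?c v"
        by blast
      then show ?thesis using w by blast
    next
      case 3
      then have "(w, x) \<in> linked (insert {u, v} X) \<longleftrightarrow> (w, x) \<in> linked X" for x
        unfolding linked_insert by blast
      then have "?d w = ?c w"
        by blast
      moreover have "?c w \<noteq> ?c u" "?c w \<noteq> ?c v"
        using 3 linked_class_eq by metis+
      ultimately show ?thesis using w by blast
    qed
  qed
  have "card (?d ` V) \<le> card (insert (?c u \<union> ?c v) (?c ` V - {?c u, ?c v}))"
    by (rule card_mono[OF _ sub]) (simp add: V)
  also have "\<dots> \<le> Suc (card (?c ` V - {?c u, ?c v}))"
    by (rule card_insert_le_m1[where n="Suc n" for n, simplified]) simp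
  also have "\<dots> = Suc (card (?c ` V) - 2)"
    using V uv by (subst card_Diff_subset) auto
  finally have "card (?d ` V) \<le> Suc (card (?c ` V) - 2)" .
  moreover have "card {?c u, ?c v} \<le> card (?c ` V)"
    by (rule card_mono) (use V in auto)
  ultimately show ?thesis
    using uv by (simp add: class_count_def)
qed

section \<open>Faces of a plane drawing\<close>

text \<open>Only edges are drawn. Isolated vertices do not affect the faces and enter later through
  the set \<open>V\<close> in Euler's inequality.\<close>

locale plane_arcs =
  fixes E :: "'a set set" and p :: "'a \<Rightarrow> complex" and \<gamma> :: "'a set \<Rightarrow> real \<Rightarrow> complex"
  assumes finite_edges: "finite E"
    and edge_pair: "e \<in> E \<Longrightarrow> \<exists>u v. u \<noteq> v \<and> e = {u, v}"
    and inj_p: "inj_on p (\<Union>E)"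
    and arc_edge: "e \<in> E \<Longrightarrow> arc (\<gamma> e)"
    and edge_ends: "e \<in> E \<Longrightarrow> {pathstart (\<gamma> e), pathfinish (\<gamma> e)} = p ` e"
    and edges_meet: "e \<in> E \<Longrightarrow> e' \<in> E \<Longrightarrow> e \<noteq> e' \<Longrightarrow>
      path_image (\<gamma> e) \<inter> path_image (\<gamma> e') \<subseteq> p ` (e \<inter> e')"
begin

definition support :: "'a set set \<Rightarrow> complex set" where
  "support X = (\<Union>e\<in>X. path_image (\<gamma> e))"

definition eint :: "'a set \<Rightarrow> complex set" where
  "eint e = path_image (\<gamma> e) - p ` e"

definition faces :: "'a set set \<Rightarrow> complex set set" where
  "faces X = components (- support X)"

text \<open>Testing \<open>eint e\<close> excludes edges that touch the face only at an end. Nothing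
  is lost by taking a set: in a bridgeless drawing every edge has two different faces.\<close>

definition border :: "'a set set \<Rightarrow> complex set \<Rightarrow> 'a set set" where
  "border X f = {e \<in> X. eint e \<inter> closure f \<noteq> {}}"

lemma support_insert: "support (insert e X) = support X \<union> path_image (\<gamma> e)"
  by (auto simp: support_def)

lemma closed_support: "X \<subseteq> E \<Longrightarrow> closed (support X)"
  unfolding support_def using finite_edges arc_edge
  by (intro closed_UN) (auto simp: closed_arc_image finite_subset)

lemma ends_in_edge: "e \<in> E \<Longrightarrow> p ` e \<subseteq> path_image (\<gamma> e)"
  using edge_ends by (metis bot.extremum insert_subset pathfinish_in_path_image pathstart_in_path_image)

lemma vertex_on_edge:
  assumes "e \<in> E" "w \<in> \<Union>E" "p w \<in> path_image (\<gamma> e)"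
  shows "w \<in> e"
proof -
  obtain e' where e': "e' \<in> E" "w \<in> e'" using assms(2) by blast
  show ?thesis
  proof (cases "e = e'")
    case False
    have "p w \<in> path_image (\<gamma> e')"
      using ends_in_edge[OF e'(1)] e'(2) by blast
    then obtain x where "x \<in> e \<inter> e'" "p w = p x"
      using edges_meet[OF assms(1) e'(1) False] assms(3) by blast
    then show ?thesis
      using inj_p assms(1,2) by (metis IntD1 UnionI inj_onD)
  qed (use e' in simp)
qed

lemma eint_nonempty: "e \<in> E \<Longrightarrow> eint e \<noteq> {}"
  unfolding eint_def using edge_ends[of e, symmetric] arc_edge[of e]
    nonempty_simple_path_endless[OF arc_imp_simple_path, of "\<gamma> e"] by simp

lemma eint_disjoint:
  assumes "e \<in> E" "e' \<in> E" "e \<noteq> e'"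
  shows "eint e \<inter> path_image (\<gamma> e') = {}"
  using edges_meet[OF assms] by (auto simp: eint_def)

lemma eint_support: "e \<in> E \<Longrightarrow> X \<subseteq> E \<Longrightarrow> e \<notin> X \<Longrightarrow> eint e \<inter> support X = {}"
  using eint_disjoint unfolding support_def by blast

lemma open_face: "X \<subseteq> E \<Longrightarrow> f \<in> faces X \<Longrightarrow> open f"
  unfolding faces_def using closed_support open_components open_Compl by metis

lemma face_subset: "f \<in> faces X \<Longrightarrow> f \<inter> support X = {}"
  unfolding faces_def using in_components_subset by blast

lemma face_nonempty: "f \<in> faces X \<Longrightarrow> f \<noteq> {}"
  unfolding faces_def by (rule in_components_nonempty)

lemma face_connected: "f \<in> faces X \<Longrightarrow> connected f"
  unfolding faces_def by (rule in_components_connected)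

lemma face_eq: "f \<in> faces X \<Longrightarrow> g \<in> faces X \<Longrightarrow> f \<inter> g \<noteq> {} \<Longrightarrow> f = g"
  unfolding faces_def using components_eq by metis

lemma face_maximal: "f \<in> faces X \<Longrightarrow> connected C \<Longrightarrow> C \<inter> support X = {} \<Longrightarrow> f \<inter> C \<noteq> {} \<Longrightarrow> C \<subseteq> f"
  unfolding faces_def by (rule components_maximal) auto

lemma frontier_face: "X \<subseteq> E \<Longrightarrow> f \<in> faces X \<Longrightarrow> frontier f \<subseteq> support X"
  unfolding faces_def using frontier_of_components_closed_complement closed_support by blast

lemma in_some_face: "x \<notin> support X \<Longrightarrow> \<exists>f\<in>faces X. x \<in> f"
  unfolding faces_def by (metis ComplI Union_components Union_iff)

lemma faces_empty: "faces {} = {UNIV}"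
  unfolding faces_def support_def by (simp add: components_eq_sing_iff)

lemma linked_path:
  assumes "X \<subseteq> E" "(u, v) \<in> linked X" "u \<noteq> v"
  shows "path_component (support X) (p u) (p v)"
proof -
  have "u = v \<or> path_component (support X) (p u) (p v)"
    using assms(2) unfolding linked_def
  proof (induction rule: rtrancl_induct)
    case (step y z)
    have e: "{y, z} \<in> X" using step(2) by simp
    have "path_component (path_image (\<gamma> {y, z})) (p y) (p z)"
    proof -
      have "path_connected (path_image (\<gamma> {y, z}))"
        using e assms(1) arc_edge arc_imp_path path_connected_path_image by blast
      moreover have "p y \<in> path_image (\<gamma> {y, z})" "p z \<in> path_image (\<gamma> {y, z})"
        using ends_in_edge[of "{y, z}"] e assms(1) by auto
      ultimately show ?thesis
        by (simp add: path_connected_component)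
    qed
    then have yz: "path_component (support X) (p y) (p z)"
      by (rule path_component_of_subset[rotated]) (use e in \<open>auto simp: support_def\<close>)
    then show ?case
      using step.IH path_component_trans by metis
  qed simp
  then show ?thesis using assms(3) by simp
qed

text \<open>As \<open>u\<close> and \<open>v\<close> are already linked in \<open>X\<close>, the
  drawing of \<open>X\<close> contains an arc between their images, which serves as the arc
  \<open>b\<close> of \<open>arc_splits_component\<close>.\<close>

lemma edge_splits_face:
  assumes X: "X \<subseteq> E" and e: "e \<in> E" "e \<notin> X" and uv: "e = {u, v}" "(u, v) \<in> linked X"
  obtains f h h' where "f \<in> faces X" "h \<noteq> h'" "h \<in> faces (insert e X)" "h' \<in> faces (insert e X)"
    "eint e \<subseteq> closure h" "eint e \<subseteq> closure h'" "f = h \<union> h' \<union> eint e"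
proof -
  let ?c = "\<gamma> e"
  have "u \<noteq> v"
    using edge_pair[OF e(1)] uv(1) by (auto simp: doubleton_eq_iff)
  have ends: "{pathstart ?c, pathfinish ?c} = {p u, p v}"
    using edge_ends[OF e(1)] uv(1) by simp
  have "path_component (support X) (p u) (p v)"
    using linked_path[OF X uv(2) \<open>u \<noteq> v\<close>] .
  then have "path_component (support X) (pathstart ?c) (pathfinish ?c)"
    using ends path_component_sym by (auto simp: doubleton_eq_iff)
  then obtain g where "path g" "path_image g \<subseteq> support X" "pathstart g = pathstart ?c" "pathfinish g = pathfinish ?c"
    unfolding path_component_def by blast
  moreover have "pathstart ?c \<noteq> pathfinish ?c"
    using arc_distinct_ends[OF arc_edge[OF e(1)]] by simp
  ultimately obtain b where b: "arc b" "path_image b \<subseteq> support X" "pathstart b = pathstart ?c" "pathfinish b = pathfinish ?c"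
    using path_contains_arc[of g "pathstart ?c" "pathfinish ?c"] by (metis subset_trans)
  have meet: "path_image ?c \<inter> support X = {pathstart ?c, pathfinish ?c}"
  proof
    show "path_image ?c \<inter> support X \<subseteq> {pathstart ?c, pathfinish ?c}"
      using eint_support[OF e(1) X e(2)] edge_ends[OF e(1)] by (auto simp: eint_def)
    show "{pathstart ?c, pathfinish ?c} \<subseteq> path_image ?c \<inter> support X"
      using b pathstart_in_path_image[of b] pathfinish_in_path_image[of b] by auto
  qed
  have I: "path_image ?c - {pathstart ?c, pathfinish ?c} = eint e"
    using edge_ends[OF e(1)] by (simp add: eint_def)
  show thesis
    using arc_splits_component[OF arc_edge[OF e(1)] b(1,3,4) closed_support[OF X] b(2) meet] that
    unfolding I faces_def support_insert by metis
qed

section \<open>Borders of faces in a bridgeless drawing\<close>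

definition bridgeless :: "'a set set \<Rightarrow> bool" where
  "bridgeless X \<longleftrightarrow> (\<forall>u v. {u, v} \<in> X \<longrightarrow> (u, v) \<in> linked (X - {{u, v}}))"

text \<open>Reinserting \<open>e\<close> into \<open>X - {e}\<close> splits a face \<open>f\<close>
  into \<open>h\<close> and \<open>h'\<close>. Since \<open>f\<close> is an open neighbourhood of
  \<open>eint e\<close>, no further face can have \<open>e\<close> on its border. The openness
  clause is what the connectedness argument of \<open>faces_adjacent_all\<close> needs.\<close>

lemma two_sides:
  assumes X: "X \<subseteq> E" "bridgeless X" and e: "e \<in> X"
  obtains h h' where "h \<noteq> h'" "{f \<in> faces X. e \<in> border X f} = {h, h'}"
    "eint e \<subseteq> closure h" "eint e \<subseteq> closure h'" "open (h \<union> h' \<union> eint e)"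
proof -
  have eE: "e \<in> E" using X e by blast
  obtain u v where uv: "e = {u, v}"
    using edge_pair[OF eE] by blast
  have sub: "X - {e} \<subseteq> E" and ins: "insert e (X - {e}) = X"
    using X e by auto
  have "(u, v) \<in> linked (X - {e})"
    using X(2) e uv by (simp add: bridgeless_def)
  then obtain f h h' where *: "f \<in> faces (X - {e})" "h \<noteq> h'" "h \<in> faces X" "h' \<in> faces X"
    "eint e \<subseteq> closure h" "eint e \<subseteq> closure h'" "f = h \<union> h' \<union> eint e"
    using edge_splits_face[OF sub eE _ uv] ins by (metis Diff_iff singletonI)
  have "open f"
    using open_face[OF sub] *(1) .
  have "g = h \<or> g = h'" if g: "g \<in> faces X" "e \<in> border X g" for g
  proof -
    have "f \<inter> closure g \<noteq> {}"
      using g(2) *(7) by (auto simp: border_def)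
    then have fg: "f \<inter> g \<noteq> {}"
      using open_Int_closure_eq_empty[OF \<open>open f\<close>] by blast
    have gX: "g \<inter> support X = {}"
      using g(1) by (rule face_subset)
    then have "g \<subseteq> f"
      using fg by (intro face_maximal[OF *(1)] face_connected[OF g(1)]) (auto simp: support_def)
    moreover have "g \<inter> eint e = {}"
      using gX e by (auto simp: support_def eint_def)
    moreover have "g \<noteq> {}" using g(1) by (rule face_nonempty)
    ultimately have "g \<inter> h \<noteq> {} \<or> g \<inter> h' \<noteq> {}"
      using *(7) by blast
    then show ?thesis
      using face_eq g(1) *(3,4) by blast
  qed
  moreover have "e \<in> border X h" "e \<in> border X h'"
    using e *(5,6) eint_nonempty[OF eE] by (auto simp: border_def)
  ultimately have "{f \<in> faces X. e \<in> border X f} = {h, h'}"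
    using *(3,4) by blast
  then show thesis
    using that * \<open>open f\<close> by blast
qed

text \<open>
  If \<open>u\<close> were a dead end of the border of \<open>f\<close>, then the two sides of \<open>e\<close> could be joined around it
  without meeting the frontier of \<open>f\<close>.
\<close>

lemma border_min_degree:
  assumes X: "X \<subseteq> E" "bridgeless X" and f: "f \<in> faces X" and e: "e \<in> border X f" "u \<in> e"
  obtains e' where "e' \<in> border X f" "e' \<noteq> e" "u \<in> e'"
proof (rule ccontr)
  assume "\<not> thesis"
  then have only: "e' = e" if "e' \<in> border X f" "u \<in> e'" for e'
    using that \<open>\<And>e'. e' \<in> border X f \<Longrightarrow> e' \<noteq> e \<Longrightarrow> u \<in> e' \<Longrightarrow> thesis\<close> by blast
  have eX: "e \<in> X" and eE: "e \<in> E"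
    using e X by (auto simp: border_def)
  obtain v where v: "e = {u, v}" "u \<noteq> v"
    using edge_pair[OF eE] e(2) by (metis doubleton_eq_iff insertE singletonD)
  \<comment> \<open>All vertices but \<open>u\<close> are included because a frontier point of
    \<open>f\<close> may be an end of an edge outside the border. With them,
    \<open>frontier f\<close> is covered by \<open>T\<close> and the curve of \<open>e\<close>,
    without any knowledge of the edges around that vertex.\<close>
  define T where "T = support (border X f - {e}) \<union> (p ` \<Union>X - {p u})"
  have bX: "border X f \<subseteq> X" by (auto simp: border_def)
  have finX: "finite X" using X(1) finite_edges finite_subset by blast
  have fin: "finite (\<Union>X)"
    using finX X(1) edge_pair by (metis finite.emptyI finite.insertI finite_Union subsetD)
  have "closed T"
    unfolding T_def using closed_support[of "border X f - {e}"] bX X(1) fin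
    by (intro closed_Un) (auto intro: finite_imp_closed)
  have uvE: "u \<in> \<Union>E" "v \<in> \<Union>E" using v eE by auto
  then have "p u \<noteq> p v"
    using inj_p v(2) by (metis inj_onD)
  have meet: "path_image (\<gamma> e) \<inter> T = {p v}"
  proof
    show "path_image (\<gamma> e) \<inter> T \<subseteq> {p v}"
    proof
      fix x assume x: "x \<in> path_image (\<gamma> e) \<inter> T"
      show "x \<in> {p v}"
      proof (cases "x \<in> p ` \<Union>X - {p u}")
        case True
        then obtain w where w: "w \<in> \<Union>X" "x = p w" "p w \<noteq> p u" by blast
        then have "w \<in> e"
          using x X(1) by (intro vertex_on_edge[OF eE]) auto
        then show ?thesis using w v by auto
      next
        case False
        then obtain e' where e': "e' \<in> border X f" "e' \<noteq> e" "x \<in> path_image (\<gamma> e')"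
          using x by (auto simp: T_def support_def)
        then have "x \<in> p ` (e \<inter> e')"
          using edges_meet[OF eE, of e'] bX X(1) x by blast
        moreover have "u \<notin> e'"
          using only e' by blast
        ultimately show ?thesis using v by auto
      qed
    qed
    show "{p v} \<subseteq> path_image (\<gamma> e) \<inter> T"
      using ends_in_edge[OF eE] v eX \<open>p u \<noteq> p v\<close> by (auto simp: T_def)
  qed
  have "p v \<in> {pathstart (\<gamma> e), pathfinish (\<gamma> e)}"
    using edge_ends[OF eE] v by auto
  then obtain U where U: "open U" "path_image (\<gamma> e) - {pathstart (\<gamma> e), pathfinish (\<gamma> e)} \<subseteq> U"
    "\<And>x y. x \<in> U - path_image (\<gamma> e) \<Longrightarrow> y \<in> U - path_image (\<gamma> e) \<Longrightarrow>
       connected_component (- (T \<union> path_image (\<gamma> e))) x y"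
    using arc_dead_end[OF arc_edge[OF eE] \<open>closed T\<close> meet] by blast
  have IU: "eint e \<subseteq> U"
    using U(2) edge_ends[OF eE] by (simp add: eint_def)
  obtain h h' where h: "h \<noteq> h'" "{f \<in> faces X. e \<in> border X f} = {h, h'}"
    "eint e \<subseteq> closure h" "eint e \<subseteq> closure h'"
    using two_sides[OF X eX] by metis
  define g where "g = (if f = h then h' else h)"
  have "f = h \<or> f = h'" using h(2) f e(1) by blast
  then have g: "g \<noteq> f" "g \<in> faces X" "eint e \<subseteq> closure g" "eint e \<subseteq> closure f"
    using h by (auto simp: g_def)
  obtain m where m: "m \<in> eint e" using eint_nonempty[OF eE] by blast
  have "U \<inter> closure f \<noteq> {}" "U \<inter> closure g \<noteq> {}"
    using m IU g(3,4) by blast+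
  then have "U \<inter> f \<noteq> {}" "U \<inter> g \<noteq> {}"
    using open_Int_closure_eq_empty[OF U(1)] by metis+
  then obtain a b where ab: "a \<in> U" "a \<in> f" "b \<in> U" "b \<in> g"
    by blast
  have "a \<notin> path_image (\<gamma> e)" "b \<notin> path_image (\<gamma> e)"
    using ab face_subset[OF f] face_subset[OF g(2)] eX by (auto simp: support_def)
  then obtain C where C: "connected C" "C \<inter> (T \<union> path_image (\<gamma> e)) = {}" "a \<in> C" "b \<in> C"
    using U(3)[of a b] ab unfolding connected_component_def by blast
  have fr: "frontier f \<subseteq> T \<union> path_image (\<gamma> e)"
  proof
    fix x assume x: "x \<in> frontier f"
    then obtain e' where e': "e' \<in> X" "x \<in> path_image (\<gamma> e')"
      using frontier_face[OF X(1) f] by (auto simp: support_def)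
    show "x \<in> T \<union> path_image (\<gamma> e)"
    proof (cases "x \<in> p ` e'")
      case True
      then have "x \<in> p ` \<Union>X" using e' by blast
      moreover have "p u \<in> path_image (\<gamma> e)" using ends_in_edge[OF eE] v by blast
      ultimately show ?thesis by (auto simp: T_def)
    next
      case False
      then have "e' \<in> border X f"
        using e' x by (auto simp: border_def eint_def frontier_def)
      then show ?thesis using e' by (auto simp: T_def support_def)
    qed
  qed
  have "C \<subseteq> f"
  proof (rule ccontr)
    assume "\<not> C \<subseteq> f"
    then have "C \<inter> frontier f \<noteq> {}"
      using C ab by (intro connected_Int_frontier) auto
    then show False using fr C by blast
  qed
  then have "b \<in> f \<inter> g" using C ab by blast
  then show False using face_eq[OF f g(2)] g(1) by blast
qed

text \<open>
  The dual graph is connected: the plane minus the finitely many vertices is connected, and the union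
  of a class of faces closed under adjacency, together with the edges between them, is clopen in it.
\<close>

lemma faces_adjacent_all:
  assumes X: "X \<subseteq> E" "bridgeless X" and F: "F \<subseteq> faces X" "F \<noteq> {}"
    and cl: "\<And>e f g. f \<in> F \<Longrightarrow> g \<in> faces X \<Longrightarrow> e \<in> border X f \<Longrightarrow> e \<in> border X g \<Longrightarrow> g \<in> F"
  shows "F = faces X"
proof -
  define W where "W G = \<Union>G \<union> (\<Union>e\<in>{e \<in> X. \<exists>f\<in>G. e \<in> border X f}. eint e)" for G
  have openW: "open (W G)"
    if G: "G \<subseteq> faces X" "\<And>e f g. f \<in> G \<Longrightarrow> g \<in> faces X \<Longrightarrow> e \<in> border X f \<Longrightarrow> e \<in> border X g \<Longrightarrow> g \<in> G"
    for G
  proof -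
    let ?N = "\<lambda>e. \<Union>{f \<in> faces X. e \<in> border X f} \<union> eint e"
    \<comment> \<open>Both faces at such an edge belong to \<open>G\<close>, so enlarging
      \<open>eint e\<close> to the open set \<open>?N e\<close> leaves \<open>W G\<close>
      unchanged.\<close>
    have "W G = \<Union>G \<union> (\<Union>e\<in>{e \<in> X. \<exists>f\<in>G. e \<in> border X f}. ?N e)"
      unfolding W_def using G(2) by blast
    moreover have "open (?N e)" if e: "e \<in> X" for e
    proof -
      obtain h h' where "{f \<in> faces X. e \<in> border X f} = {h, h'}" "open (h \<union> h' \<union> eint e)"
        using two_sides[OF X e] by metis
      then show ?thesis by simp
    qed
    moreover have "open (\<Union>G)"
      using G(1) open_face[OF X(1)] by blast
    ultimately show ?thesis
      by (metis (no_types, lifting) mem_Collect_eq open_UN open_Un)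
  qed
  let ?F' = "faces X - F"
  have finX: "finite X" using X(1) finite_edges finite_subset by blast
  have fin: "finite (p ` \<Union>X)"
    using finX X(1) edge_pair by (metis finite.emptyI finite.insertI finite_Union finite_imageI subsetD)
  have conn: "connected (- (p ` \<Union>X))"
    using path_connected_complement_countable[of "p ` \<Union>X"] fin
    by (simp add: countable_finite path_connected_imp_connected)
  have "open (W F)"
    using F(1) cl by (rule openW)
  have cl': "g \<in> ?F'" if "f \<in> ?F'" "g \<in> faces X" "e \<in> border X f" "e \<in> border X g" for e f g
    using cl[of g f e] that by auto
  have "open (W ?F')"
    using _ cl' by (rule openW) auto
  have "W F \<inter> W ?F' = {}"
  proof -
    have "f \<inter> g = {}" if "f \<in> F" "g \<in> ?F'" for f g
      using that F(1) face_eq by blast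
    moreover have "f \<inter> eint e = {}" if "f \<in> faces X" "e \<in> X" for f e
      using face_subset[OF that(1)] that(2) by (auto simp: support_def eint_def)
    moreover have "eint e \<inter> eint e' = {}" if "e \<in> X" "e' \<in> X" "e \<noteq> e'" for e e'
      using eint_disjoint[of e e'] that X(1) by (auto simp: eint_def)
    moreover have "\<not> (\<exists>f\<in>?F'. e \<in> border X f)" if "f \<in> F" "e \<in> border X f" for e f
      using that cl by blast
    ultimately show ?thesis
      using F(1) unfolding W_def by (simp add: Int_Un_distrib Int_Un_distrib2) blast
  qed
  have "- (p ` \<Union>X) \<subseteq> W F \<union> W ?F'"
  proof
    fix x assume x: "x \<in> - (p ` \<Union>X)"
    show "x \<in> W F \<union> W ?F'"
    proof (cases "x \<in> support X")
      case True
      then obtain e where e: "e \<in> X" "x \<in> eint e"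
        using x by (auto simp: support_def eint_def)
      obtain h h' where "{f \<in> faces X. e \<in> border X f} = {h, h'}"
        using two_sides[OF X e(1)] by metis
      then obtain f where "f \<in> faces X" "e \<in> border X f" by blast
      then show ?thesis using e by (cases "f \<in> F") (auto simp: W_def)
    next
      case False
      then obtain f where "f \<in> faces X" "x \<in> f" using in_some_face by blast
      then show ?thesis by (auto simp: W_def)
    qed
  qed
  moreover have "W F \<inter> W ?F' \<inter> - (p ` \<Union>X) = {}"
    unfolding \<open>W F \<inter> W ?F' = {}\<close> by (rule Int_empty_left)
  ultimately have cases: "W F \<inter> - (p ` \<Union>X) = {} \<or> W ?F' \<inter> - (p ` \<Union>X) = {}"
    using connectedD[OF conn \<open>open (W F)\<close> \<open>open (W ?F')\<close>] by metis
  have off: "f \<inter> p ` \<Union>X = {}" if "f \<in> faces X" for f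
    using face_subset[OF that] ends_in_edge X(1) unfolding support_def by blast
  have empty: "G = {}" if "W G \<inter> - (p ` \<Union>X) = {}" "G \<subseteq> faces X" for G
  proof (rule ccontr)
    assume "G \<noteq> {}"
    then obtain f where f: "f \<in> G" by blast
    then have "f \<in> faces X" using that(2) by blast
    then obtain x where "x \<in> f" using face_nonempty by blast
    then have "x \<in> W G" "x \<notin> p ` \<Union>X"
      using off[OF \<open>f \<in> faces X\<close>] f by (auto simp: W_def)
    then show False
      using that(1) by blast
  qed
  from cases have "F = {} \<or> ?F' = {}"
    using empty[OF _ F(1)] empty[of ?F'] by auto
  then show ?thesis using F by blast
qed

text \<open>An arc cannot cover an open face, so some point of \<open>f\<close> survives; its new
  face stays in \<open>f\<close> because the drawing has only grown. Choosing such faces shows that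
  inserting an edge never lowers the number of faces.\<close>

lemma face_below:
  assumes "X \<subseteq> E" "e \<in> E" "f \<in> faces X"
  shows "\<exists>g\<in>faces (insert e X). g \<subseteq> f"
proof -
  have "\<not> f \<subseteq> path_image (\<gamma> e)"
    using arc_no_open_subset[OF arc_edge[OF assms(2)] open_face[OF assms(1,3)]] face_nonempty[OF assms(3)]
    by blast
  then obtain a where a: "a \<in> f" "a \<notin> path_image (\<gamma> e)" by blast
  then have "a \<notin> support (insert e X)"
    using face_subset[OF assms(3)] by (auto simp: support_insert)
  then obtain g where g: "g \<in> faces (insert e X)" "a \<in> g" using in_some_face by blast
  have "g \<subseteq> f"
    using g a face_subset[OF g(1)] face_connected[OF g(1)]
    by (intro face_maximal[OF assms(3)]) (auto simp: support_insert)
  then show ?thesis using g by blast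
qed

text \<open>Edges are inserted one by one: an edge within a class splits a face, any other edge
  merges two classes and loses no face. A finite set \<open>S\<close> replaces
  \<open>faces X\<close> because finiteness is known only later, for bridgeless \<open>X\<close>,
  and \<open>card\<close> of an infinite set is \<open>0\<close>.\<close>

lemma euler_lower_bound:
  assumes V: "finite V" "\<Union>E \<subseteq> V" and "X \<subseteq> E"
  shows "\<exists>S. finite S \<and> S \<subseteq> faces X \<and> 1 + card X + class_count V X \<le> card S + card V"
proof -
  have "finite X" using assms(3) finite_edges finite_subset by blast
  then show ?thesis
    using assms(3)
  proof (induction X rule: finite_induct)
    case empty
    have "class_count V {} \<le> card V"
      unfolding class_count_def using V(1) by (rule card_image_le)
    then show ?case
      by (intro exI[of _ "{UNIV}"]) (simp add: faces_empty)
  next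
    case (insert e X)
    then have X: "X \<subseteq> E" and e: "e \<in> E" by auto
    obtain S where S: "finite S" "S \<subseteq> faces X" "1 + card X + class_count V X \<le> card S + card V"
      using insert by blast
    have "\<forall>f\<in>faces X. \<exists>g. g \<in> faces (insert e X) \<and> g \<subseteq> f"
      using face_below[OF X e] by blast
    then obtain k where k: "\<And>f. f \<in> faces X \<Longrightarrow> k f \<in> faces (insert e X)" "\<And>f. f \<in> faces X \<Longrightarrow> k f \<subseteq> f"
      by metis
    have inj: "inj_on k S"
    proof (rule inj_onI)
      fix f g assume fg: "f \<in> S" "g \<in> S" "k f = k g"
      then have fg': "f \<in> faces X" "g \<in> faces X" using S(2) by auto
      then have "k f \<noteq> {}" using face_nonempty[OF k(1)] by simp
      moreover have "k f \<subseteq> f \<inter> g" using k(2)[OF fg'(1)] k(2)[OF fg'(2)] fg(3) by simp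
      ultimately show "f = g" using face_eq[OF fg'] by auto
    qed
    obtain u v where uv: "e = {u, v}" using edge_pair[OF e] by blast
    then have uvV: "u \<in> V" "v \<in> V" using V(2) e by auto
    show ?case
    proof (cases "(u, v) \<in> linked X")
      case False
      then have "class_count V (insert e X) + 1 \<le> class_count V X"
        using class_count_insert_unlinked[OF V(1) uvV] uv by simp
      moreover have "card (k ` S) = card S" using inj by (rule card_image)
      ultimately show ?thesis
        using S(1,3) insert(1,2) image_subsetI[of S k "faces (insert e X)"] k(1) S(2)
        by (intro exI[of _ "k ` S"]) auto
    next
      case True
      then have cc: "class_count V (insert e X) = class_count V X"
        using class_count_insert_linked uv by metis
      obtain f h h' where f: "f \<in> faces X" "h \<noteq> h'" "h \<in> faces (insert e X)" "h' \<in> faces (insert e X)"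
        "f = h \<union> h' \<union> eint e"
        using edge_splits_face[OF X e insert(2) uv True] by metis
      \<comment> \<open>The two pieces of \<open>f\<close> are new, since all other chosen faces lie
        off \<open>f\<close>. The count grows by at least one whether or not \<open>f\<close> was in
        \<open>S\<close>.\<close>
      let ?S = "insert h (insert h' (k ` (S - {f})))"
      have no: "k g \<inter> f = {}" if "g \<in> S - {f}" for g
      proof -
        have "g \<inter> f = {}" using face_eq[of g X f] that S(2) f(1) by auto
        then show ?thesis using k(2)[of g] that S(2) by auto
      qed
      have "h \<notin> k ` (S - {f})" "h' \<notin> k ` (S - {f})"
        using no f(5) face_nonempty[OF f(3)] face_nonempty[OF f(4)] by (metis Int_Un_distrib Un_empty image_iff inf.idem)+
      then have "card ?S = card (k ` (S - {f})) + 2"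
        using f(2) S(1) by simp
      also have "card (k ` (S - {f})) = card (S - {f})"
        using inj by (intro card_image) (auto intro: inj_on_subset)
      finally have "card ?S \<ge> card S + 1"
        using diff_card_le_card_Diff[of "{f}" S] by simp
      moreover have "?S \<subseteq> faces (insert e X)"
        using f(3,4) k(1) S(2) by auto
      ultimately show ?thesis
        using S(1,3) cc insert(1,2) by (intro exI[of _ ?S]) auto
    qed
  qed
qed

text \<open>
  \<open>E - X\<close> plays the role of the bridges: deleting it raises the number of components by at least its
  size.
\<close>

lemma exists_bridgeless_subgraph:
  assumes V: "finite V" "\<Union>E \<subseteq> V" "V \<noteq> {}"
  obtains X where "X \<subseteq> E" "bridgeless X" "1 + card (E - X) \<le> class_count V X"
proof -
  let ?P = "\<lambda>X. X \<subseteq> E \<and> 1 + card (E - X) \<le> class_count V X"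
  have "?P E"
    using V by (simp add: class_count_def Suc_le_eq card_gt_0_iff)
  \<comment> \<open>A smallest such \<open>X\<close> has no bridge, because deleting a bridge would
    preserve the inequality.\<close>
  then obtain X where X: "?P X" and min: "\<And>Y. card Y < card X \<Longrightarrow> \<not> ?P Y"
    using ex_has_least_nat[of ?P E card] by (metis leD)
  have finX: "finite X" using X finite_edges finite_subset by blast
  have "bridgeless X"
    unfolding bridgeless_def
  proof (intro allI impI, rule ccontr)
    fix u v assume e: "{u, v} \<in> X" and not: "(u, v) \<notin> linked (X - {{u, v}})"
    have "u \<in> V" "v \<in> V" using e X V(2) by auto
    then have "class_count V X + 1 \<le> class_count V (X - {{u, v}})"
      using class_count_insert_unlinked[OF V(1) _ _ not] e by (simp add: insert_absorb)
    moreover have "E - (X - {{u, v}}) = insert {u, v} (E - X)" using e X by blast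
    then have "card (E - (X - {{u, v}})) = Suc (card (E - X))"
      using e finite_edges by simp
    ultimately have "?P (X - {{u, v}})" using X by auto
    moreover have "card (X - {{u, v}}) < card X"
      using e finX by (intro card_Diff1_less)
    ultimately show False using min by blast
  qed
  then show thesis using that X by blast
qed

text \<open>A face without border edges is closed under adjacency by itself, hence the only face;
  but every edge of \<open>X\<close> borders some face.\<close>

lemma border_nonempty:
  assumes X: "X \<subseteq> E" "bridgeless X" "X \<noteq> {}" and f: "f \<in> faces X"
  shows "border X f \<noteq> {}"
proof
  assume none: "border X f = {}"
  have all: "{f} = faces X"
    by (rule faces_adjacent_all[OF X(1,2)]) (use f none in auto)
  obtain e where e: "e \<in> X" using X(3) by blast
  obtain h h' where "{f \<in> faces X. e \<in> border X f} = {h, h'}"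
    using two_sides[OF X(1,2) e] by metis
  then have "h \<in> faces X" "e \<in> border X h" by auto
  then show False using none all by auto
qed

text \<open>At each edge of the common border \<open>f\<close> and \<open>g\<close> are the two
  faces, so \<open>{f, g}\<close> is closed under adjacency and contains all faces. Hence every edge
  of \<open>X\<close> lies on that border.\<close>

lemma equal_borders:
  assumes X: "X \<subseteq> E" "bridgeless X" and f: "f \<in> faces X" "g \<in> faces X" "f \<noteq> g" "border X f = border X g"
  shows "border X f = X"
proof -
  have two: "{f' \<in> faces X. e \<in> border X f'} = {f, g}" if e: "e \<in> border X f" for e
  proof -
    have eX: "e \<in> X" using e by (simp add: border_def)
    obtain h h' where hh: "{f' \<in> faces X. e \<in> border X f'} = {h, h'}"
      using two_sides[OF X eX] by metis
    have "f \<in> {h, h'}" "g \<in> {h, h'}" using hh f e by auto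
    then show ?thesis using hh f(3) by auto
  qed
  have "{f, g} = faces X"
  proof (rule faces_adjacent_all[OF X])
    fix e f' g' assume "f' \<in> {f, g}" "g' \<in> faces X" "e \<in> border X f'" "e \<in> border X g'"
    then have "e \<in> border X f" "g' \<in> {f' \<in> faces X. e \<in> border X f'}"
      using f(4) by auto
    then show "g' \<in> {f, g}"
      using two by blast
  qed (use f in auto)
  moreover have "e \<in> border X f" if eX: "e \<in> X" for e
  proof -
    obtain h h' where "{f' \<in> faces X. e \<in> border X f'} = {h, h'}"
      using two_sides[OF X eX] by metis
    then show ?thesis using calculation f(4) by blast
  qed
  ultimately show ?thesis by (auto simp: border_def)
qed

lemma finite_faces:
  assumes X: "X \<subseteq> E" "bridgeless X"
  shows "finite (faces X)"
proof (cases "X = {}")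
  case True
  then show ?thesis by (simp add: faces_empty)
next
  case False
  have "faces X \<subseteq> (\<Union>e\<in>X. {f \<in> faces X. e \<in> border X f})"
    using border_nonempty[OF X False] by (fastforce simp: border_def)
  moreover have "finite {f \<in> faces X. e \<in> border X f}" if "e \<in> X" for e
    using two_sides[OF X that] by (metis finite.emptyI finite.insertI)
  moreover have "finite X" using X(1) finite_edges finite_subset by blast
  ultimately show ?thesis using finite_subset by blast
qed

lemma card_faces_of_edge:
  assumes "X \<subseteq> E" "bridgeless X" "e \<in> X"
  shows "card {f \<in> faces X. e \<in> border X f} = 2"
proof -
  obtain h h' where "h \<noteq> h'" "{f \<in> faces X. e \<in> border X f} = {h, h'}"
    using two_sides[OF assms] by metis
  then show ?thesis by simp
qed

end

section \<open>Discharging\<close>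

text \<open>The combinatorial content of a counterexample: faces are abstract objects with borders
  as edge sets, \<open>X\<close> is the bridgeless part, and \<open>far\<close> says that no swap of
  two vertices yields depth at most \<open>5\<close>. The locale is refuted by
  \<open>inconsistent\<close>.\<close>

locale dense_map =
  fixes V :: "'a set" and E X :: "'a set set" and Phi :: "'f set" and \<delta> :: "'f \<Rightarrow> 'a set set"
  assumes finite_V: "finite V"
    and edge_ex: "e \<in> E \<Longrightarrow> \<exists>u v. u \<in> V \<and> v \<in> V \<and> u \<noteq> v \<and> e = {u, v}"
    and X_sub: "X \<subseteq> E"
    and finite_Phi: "finite Phi"
    and \<delta>_sub: "f \<in> Phi \<Longrightarrow> \<delta> f \<subseteq> X"
    and \<delta>_two: "e \<in> X \<Longrightarrow> card {f \<in> Phi. e \<in> \<delta> f} = 2"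
    and \<delta>_min_degree: "f \<in> Phi \<Longrightarrow> e \<in> \<delta> f \<Longrightarrow> u \<in> e \<Longrightarrow> \<exists>e'\<in>\<delta> f. e' \<noteq> e \<and> u \<in> e'"
    and \<delta>_nonempty: "X \<noteq> {} \<Longrightarrow> f \<in> Phi \<Longrightarrow> \<delta> f \<noteq> {}"
    and \<delta>_inj: "f \<in> Phi \<Longrightarrow> g \<in> Phi \<Longrightarrow> f \<noteq> g \<Longrightarrow> \<delta> f = \<delta> g \<Longrightarrow> \<delta> f = X"
    and one_face: "X = {} \<Longrightarrow> card Phi \<le> 1"
    and euler: "card E + 2 \<le> card Phi + card V"
    and two_vertices: "2 \<le> card V"
    and far: "u \<in> V \<Longrightarrow> v \<in> V \<Longrightarrow> u \<noteq> v \<Longrightarrow>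
      6 \<le> card (({w. {u, w} \<in> E} - {w. {v, w} \<in> E}) \<union> ({w. {v, w} \<in> E} - {w. {u, w} \<in> E}) - {u, v})"
begin

section \<open>Degree inequalities\<close>

definition N :: "'a \<Rightarrow> 'a set" where "N v = {w. {v, w} \<in> E}"

definition d :: "'a \<Rightarrow> nat" where "d v = card (N v)"

lemma adj: "{u, v} \<in> E \<Longrightarrow> u \<in> V \<and> v \<in> V \<and> u \<noteq> v"
  using edge_ex[of "{u, v}"] by (auto simp: doubleton_eq_iff)

lemma N_sym: "w \<in> N v \<longleftrightarrow> v \<in> N w"
  by (simp add: N_def insert_commute)

lemma N_sub: "N v \<subseteq> V" and N_irrefl: "v \<notin> N v"
  using adj[of v] adj[of v v] by (auto simp: N_def)

lemma finite_N: "finite (N v)"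
  using N_sub finite_V finite_subset by blast

lemma finite_E: "finite E"
proof (rule finite_subset)
  show "E \<subseteq> Pow V" using edge_ex by blast
qed (simp add: finite_V)

lemma finite_X: "finite X"
  using X_sub finite_E finite_subset by blast

lemma finite_\<delta>: "f \<in> Phi \<Longrightarrow> finite (\<delta> f)"
  using \<delta>_sub finite_X finite_subset by blast

text \<open>The neighbourhoods differ in \<open>d u + d v - 2 * card (N u \<inter> N v)\<close>
  vertices. If \<open>u\<close> and \<open>v\<close> are adjacent, both are among these, but
  \<open>far\<close> does not count them; this yields the extra \<open>2\<close>.\<close>

lemma degree_sum:
  assumes uv: "u \<in> V" "v \<in> V" "u \<noteq> v"
  shows "6 + 2 * card (N u \<inter> N v) + (if v \<in> N u then 2 else 0) \<le> d u + d v"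
proof -
  let ?S = "(N u - N v) \<union> (N v - N u)"
  have fin: "finite (N u)" "finite (N v)" by (rule finite_N)+
  have "card ?S = card (N u - N v) + card (N v - N u)"
    using fin by (intro card_Un_disjoint) auto
  moreover have "card (N u) = card (N u - N v) + card (N u \<inter> N v)"
    using fin by (metis Int_commute card_Diff_subset_Int card_mono finite_Int inf.cobounded1 le_add_diff_inverse2)
  moreover have "card (N v) = card (N v - N u) + card (N u \<inter> N v)"
    using fin by (metis Int_commute card_Diff_subset_Int card_mono finite_Int inf.cobounded1 le_add_diff_inverse2)
  ultimately have sum: "d u + d v = card ?S + 2 * card (N u \<inter> N v)"
    by (simp add: d_def)
  have far': "6 \<le> card (?S - {u, v})"
    using far[OF uv] by (simp add: N_def)
  show ?thesis
  proof (cases "v \<in> N u")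
    case True
    then have "{u, v} \<subseteq> ?S"
      using N_sym N_irrefl by blast
    then have "card (?S - {u, v}) = card ?S - 2" "2 \<le> card ?S"
      using card_Diff_subset[of "{u, v}" ?S] card_mono[of ?S "{u, v}"] uv(3) fin by simp_all
    then show ?thesis using True far' sum by simp
  next
    case False
    have "card (?S - {u, v}) \<le> card ?S"
      using fin by (intro card_mono) auto
    then show ?thesis using False far' sum by simp
  qed
qed

lemma share_degree:
  assumes "u \<noteq> v" "w \<in> N u" "w \<in> N v"
  shows "8 + (if v \<in> N u then 2 else 0) \<le> d u + d v"
proof -
  have "u \<in> V" "v \<in> V" using assms adj by (auto simp: N_def)
  moreover have "card {w} \<le> card (N u \<inter> N v)"
    by (rule card_mono) (use assms finite_N in auto)
  ultimately show ?thesis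
    using degree_sum[of u v] assms(1) by (auto split: if_splits)
qed

lemma share_two_degree:
  assumes "u \<noteq> v" "{x, y} \<subseteq> N u \<inter> N v" "x \<noteq> y"
  shows "10 \<le> d u + d v"
proof -
  have "u \<in> V" "v \<in> V" using assms adj by (auto simp: N_def)
  moreover have "card {x, y} \<le> card (N u \<inter> N v)"
    by (rule card_mono) (use assms finite_N in auto)
  ultimately show ?thesis
    using degree_sum[of u v] assms(1,3) by (auto split: if_splits)
qed

lemma few_low: "card {v \<in> V. d v \<le> 2} \<le> 1"
proof (rule ccontr)
  assume "\<not> card {v \<in> V. d v \<le> 2} \<le> 1"
  then obtain u v where "u \<in> V" "v \<in> V" "u \<noteq> v" "d u \<le> 2" "d v \<le> 2"
    by (auto simp: card_le_Suc0_iff_eq finite_V)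
  then show False using degree_sum[of u v] by simp
qed

lemma many_vertices: "8 \<le> real (card V)"
proof -
  obtain u v where uv: "u \<in> V" "v \<in> V" "u \<noteq> v"
    using two_vertices finite_V by (metis card_le_Suc0_iff_eq not_less_eq_eq numeral_2_eq_2)
  let ?S = "(N u - N v) \<union> (N v - N u) - {u, v}"
  have "card ?S \<le> card (V - {u, v})"
    using N_sub finite_V by (intro card_mono) auto
  also have "\<dots> = card V - 2" using uv finite_V by simp
  finally have "8 \<le> card V" using far[OF uv] by (simp add: N_def)
  then show ?thesis by simp
qed

section \<open>Double counting of edges, ends and borders\<close>

lemma handshake:
  "(\<Sum>v\<in>V. \<Sum>w\<in>N v. h v {v, w}) = (\<Sum>e\<in>E. \<Sum>v\<in>e. (h v e :: real))"
proof -
  have "(\<Sum>e\<in>E. \<Sum>v\<in>e. h v e) = (\<Sum>e\<in>E. \<Sum>v\<in>{v \<in> V. v \<in> e}. h v e)"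
    by (intro sum.cong refl) (use edge_ex in blast)
  also have "\<dots> = (\<Sum>v\<in>V. \<Sum>e\<in>{e \<in> E. v \<in> e}. h v e)"
    by (rule sum.swap_restrict[OF finite_E finite_V])
  also have "\<dots> = (\<Sum>v\<in>V. \<Sum>w\<in>N v. h v {v, w})"
  proof (rule sum.cong[OF refl])
    fix v assume "v \<in> V"
    have "{e \<in> E. v \<in> e} = (\<lambda>w. {v, w}) ` N v"
    proof
      show "{e \<in> E. v \<in> e} \<subseteq> (\<lambda>w. {v, w}) ` N v"
      proof
        fix e assume e: "e \<in> {e \<in> E. v \<in> e}"
        then obtain a b where "e = {a, b}" using edge_ex[of e] by auto
        then have "e = {v, a} \<or> e = {v, b}" using e by auto
        then show "e \<in> (\<lambda>w. {v, w}) ` N v" using e by (auto simp: N_def)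
      qed
    qed (auto simp: N_def)
    moreover have "inj_on (\<lambda>w. {v, w}) (N v)"
      by (auto simp: inj_on_def doubleton_eq_iff)
    ultimately show "(\<Sum>e\<in>{e \<in> E. v \<in> e}. h v e) = (\<Sum>w\<in>N v. h v {v, w})"
      by (simp add: sum.reindex)
  qed
  finally show ?thesis by simp
qed

lemma card_edge: "e \<in> E \<Longrightarrow> card e = 2"
  using edge_ex by fastforce

lemma degree_total: "(\<Sum>v\<in>V. real (d v)) = 2 * real (card E)"
proof -
  have "(\<Sum>v\<in>V. real (d v)) = (\<Sum>v\<in>V. \<Sum>w\<in>N v. 1)"
    by (simp add: d_def)
  also have "\<dots> = (\<Sum>e\<in>E. \<Sum>v\<in>e. 1)"
    by (rule handshake)
  also have "\<dots> = (\<Sum>e\<in>E. 2)"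
    by (intro sum.cong refl) (simp add: card_edge)
  finally show ?thesis by simp
qed

text \<open>All vertices but one have degree at least 3. Against Euler's inequality, this excludes
  the degenerate cases \<open>X = {}\<close> and \<open>card X = 3\<close>.\<close>

lemma many_edges: "3 * real (card V) - 3 \<le> 2 * real (card E)"
proof -
  let ?L = "{v \<in> V. d v \<le> 2}"
  have "(\<Sum>v\<in>V. (3::real) - (if v \<in> ?L then 3 else 0)) = 3 * real (card V) - 3 * real (card ?L)"
    using finite_V by (simp add: sum_subtractf sum.If_cases Int_def)
  moreover have "(\<Sum>v\<in>V. (3::real) - (if v \<in> ?L then 3 else 0)) \<le> (\<Sum>v\<in>V. real (d v))"
    by (rule sum_mono) auto
  ultimately have "3 * real (card V) - 3 * real (card ?L) \<le> (\<Sum>v\<in>V. real (d v))"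
    by simp
  moreover have "real (card ?L) \<le> 1" using few_low by simp
  ultimately show ?thesis using degree_total by linarith
qed

lemma X_nonempty: "X \<noteq> {}"
proof
  assume "X = {}"
  then have "card Phi \<le> 1" by (rule one_face)
  then have "real (card E) + 2 \<le> 1 + real (card V)" using euler by linarith
  then show False using many_edges many_vertices by linarith
qed

lemma edge_total: "(\<Sum>f\<in>Phi. \<Sum>e\<in>\<delta> f. h e) = (\<Sum>e\<in>X. \<Sum>f\<in>{f \<in> Phi. e \<in> \<delta> f}. (h e :: real))"
proof -
  have "(\<Sum>f\<in>Phi. \<Sum>e\<in>\<delta> f. h e) = (\<Sum>f\<in>Phi. \<Sum>e\<in>{e \<in> X. e \<in> \<delta> f}. h e)"
    by (intro sum.cong refl) (use \<delta>_sub in blast)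
  also have "\<dots> = (\<Sum>e\<in>X. \<Sum>f\<in>{f \<in> Phi. e \<in> \<delta> f}. h e)"
    by (rule sum.swap_restrict[OF finite_Phi finite_X])
  finally show ?thesis .
qed

lemma border_total: "(\<Sum>f\<in>Phi. real (card (\<delta> f))) = 2 * real (card X)"
proof -
  have "(\<Sum>f\<in>Phi. real (card (\<delta> f))) = (\<Sum>f\<in>Phi. \<Sum>e\<in>\<delta> f. 1)" by simp
  also have "\<dots> = (\<Sum>e\<in>X. \<Sum>f\<in>{f \<in> Phi. e \<in> \<delta> f}. 1)"
    by (rule edge_total)
  also have "\<dots> = (\<Sum>e\<in>X. 2)"
    by (intro sum.cong refl) (simp add: \<delta>_two)
  finally show ?thesis by simp
qed

section \<open>Short borders\<close>

lemma next_edge: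
  assumes "f \<in> Phi" "{u, v} \<in> \<delta> f"
  obtains w where "{u, w} \<in> \<delta> f" "w \<noteq> v" "w \<noteq> u" "w \<in> N u"
proof -
  obtain e where e: "e \<in> \<delta> f" "e \<noteq> {u, v}" "u \<in> e"
    using \<delta>_min_degree[OF assms, of u] by blast
  then obtain w where w: "e = {u, w}" "u \<noteq> w"
    using edge_ex[of e] \<delta>_sub[OF assms(1)] X_sub by blast
  then show thesis
    using that[of w] e \<delta>_sub[OF assms(1)] X_sub by (auto simp: N_def)
qed

lemma \<delta>_edge: "f \<in> Phi \<Longrightarrow> e \<in> \<delta> f \<Longrightarrow> e \<in> E"
  using \<delta>_sub X_sub by blast

lemma border_path:
  assumes f: "f \<in> Phi" "{u, v} \<in> \<delta> f"
  obtains x y where "{u, x} \<in> \<delta> f" "x \<noteq> v" "x \<noteq> u" "{v, y} \<in> \<delta> f" "y \<noteq> u" "y \<noteq> v"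
    "card {{u, v}, {u, x}, {v, y}} = 3"
proof -
  obtain x where x: "{u, x} \<in> \<delta> f" "x \<noteq> v" "x \<noteq> u" using next_edge[OF f] by metis
  obtain y where y: "{v, y} \<in> \<delta> f" "y \<noteq> u" "y \<noteq> v"
    using next_edge[of f v u] f by (metis insert_commute)
  have "u \<noteq> v" using adj \<delta>_edge[OF f] by blast
  then have "card {{u, v}, {u, x}, {v, y}} = 3"
    using x y by (auto simp: card_insert_if doubleton_eq_iff)
  then show thesis using that x y by blast
qed

lemma border_ge_3:
  assumes f: "f \<in> Phi"
  shows "3 \<le> card (\<delta> f)"
proof -
  obtain e where e: "e \<in> \<delta> f" using \<delta>_nonempty[OF X_nonempty f] by blast
  then obtain u v where "e = {u, v}" using edge_ex[OF \<delta>_edge[OF f e]] by blast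
  then obtain x y where "{{u, v}, {u, x}, {v, y}} \<subseteq> \<delta> f" "card {{u, v}, {u, x}, {v, y}} = 3"
    using border_path[of f u v] f e by (metis empty_subsetI insert_subset)
  then show ?thesis using card_mono finite_\<delta>[OF f] by metis
qed

lemma border_triangle:
  assumes f: "f \<in> Phi" "{u, v} \<in> \<delta> f" "card (\<delta> f) = 3"
  obtains y where "\<delta> f = {{u, v}, {v, y}, {u, y}}"
proof -
  obtain x y where xy: "{u, x} \<in> \<delta> f" "x \<noteq> v" "x \<noteq> u" "{v, y} \<in> \<delta> f" "y \<noteq> u" "y \<noteq> v"
    "card {{u, v}, {u, x}, {v, y}} = 3"
    using border_path[OF f(1,2)] by metis
  have eq: "\<delta> f = {{u, v}, {u, x}, {v, y}}"
    using xy f by (intro card_subset_eq[OF finite_\<delta>[OF f(1)], symmetric]) auto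
  \<comment> \<open>The border has a second edge at \<open>x\<close>, and only \<open>{v, y}\<close>
    can be that edge.\<close>
  obtain z where "{x, z} \<in> \<delta> f" "z \<noteq> u"
    using next_edge[of f x u] f(1) xy(1) by (metis insert_commute)
  then have "x = y"
    using eq xy by (auto simp: doubleton_eq_iff)
  then show thesis using that[of y] eq by (simp add: insert_commute)
qed

text \<open>If \<open>X\<close> had three edges, every border would be \<open>X\<close>, leaving
  only two faces. This case must be excluded because there two faces share one triangle as border,
  which would spoil \<open>\<tau>_third\<close>.\<close>

lemma not_just_triangle: "card X \<noteq> 3"
proof
  assume 3: "card X = 3"
  have "card (\<delta> f) = 3" if "f \<in> Phi" for f
    using border_ge_3[OF that] card_mono[OF finite_X \<delta>_sub[OF that]] 3 by simp
  then have "(\<Sum>f\<in>Phi. real (card (\<delta> f))) = 3 * real (card Phi)" by simp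
  then have "card Phi = 2" using border_total 3 by simp
  then have "real (card E) + 2 \<le> 2 + real (card V)" using euler by linarith
  then show False using many_edges many_vertices by linarith
qed

text \<open>
  Distinct triangular faces at an edge have distinct apexes, so \<open>\<tau>\<close> bounds the number of common
  neighbours of the ends from below.
\<close>

definition third :: "'a \<Rightarrow> 'a \<Rightarrow> 'a set" where
  "third u v = {y. \<exists>f\<in>Phi. \<delta> f = {{u, v}, {v, y}, {u, y}}}"

definition \<tau> :: "'a set \<Rightarrow> nat" where
  "\<tau> e = card {f \<in> Phi. e \<in> \<delta> f \<and> card (\<delta> f) = 3}"

lemma third_edges:
  assumes "y \<in> third u v"
  shows "{u, v} \<in> X" "{v, y} \<in> X" "{u, y} \<in> X" "y \<in> N u" "y \<in> N v" "v \<in> N u" "u \<noteq> v" "y \<noteq> u" "y \<noteq> v"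
proof -
  show *: "{u, v} \<in> X" "{v, y} \<in> X" "{u, y} \<in> X"
    using assms \<delta>_sub unfolding third_def by blast+
  then show "y \<in> N u" "y \<in> N v" "v \<in> N u" using X_sub by (auto simp: N_def)
  show "u \<noteq> v" "y \<noteq> u" "y \<noteq> v" using * X_sub adj by blast+
qed

lemma third_perm: "y \<in> third u v \<longleftrightarrow> v \<in> third u y" "y \<in> third u v \<longleftrightarrow> y \<in> third v u"
proof -
  have "{{u, v}, {v, y}, {u, y}} = {{u, y}, {y, v}, {u, v}}" "{{u, v}, {v, y}, {u, y}} = {{v, u}, {u, y}, {v, y}}"
    by (simp_all add: insert_commute)
  then show "y \<in> third u v \<longleftrightarrow> v \<in> third u y" "y \<in> third u v \<longleftrightarrow> y \<in> third v u"
    unfolding third_def by simp_all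
qed

lemma finite_third: "finite (third u v)"
  using third_edges(4) finite_N finite_subset by (metis subsetI)

text \<open>Two triangular faces with the same apex would have equal borders, which would then be
  all of \<open>X\<close>.\<close>

lemma \<tau>_third:
  assumes "u \<noteq> v"
  shows "\<tau> {u, v} = card (third u v)"
proof -
  let ?T = "{f \<in> Phi. {u, v} \<in> \<delta> f \<and> card (\<delta> f) = 3}"
  define t where "t f = (SOME y. \<delta> f = {{u, v}, {v, y}, {u, y}})" for f
  have t: "\<delta> f = {{u, v}, {v, t f}, {u, t f}}" if fT: "f \<in> ?T" for f
  proof -
    obtain y where "\<delta> f = {{u, v}, {v, y}, {u, y}}"
      using border_triangle[of f u v] fT by auto
    then show ?thesis unfolding t_def by (rule someI)
  qed
  have "bij_betw t ?T (third u v)"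
  proof (rule bij_betw_imageI)
    show "inj_on t ?T"
    proof (rule inj_onI)
      fix f g assume fg: "f \<in> ?T" "g \<in> ?T" "t f = t g"
      have "\<delta> f = \<delta> g" using t[OF fg(1)] t[OF fg(2)] fg(3) by simp
      then have "f \<noteq> g \<Longrightarrow> \<delta> f = X"
        using fg by (intro \<delta>_inj[of f g]) simp_all
      moreover have "\<delta> f \<noteq> X" using fg(1) not_just_triangle by auto
      ultimately show "f = g" by blast
    qed
    show "t ` ?T = third u v"
    proof
      show "t ` ?T \<subseteq> third u v"
      proof
        fix y assume "y \<in> t ` ?T"
        then obtain f where f: "f \<in> ?T" "y = t f" by blast
        then show "y \<in> third u v"
          using t[OF f(1)] unfolding third_def by blast
      qed
      show "third u v \<subseteq> t ` ?T"
      proof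
        fix y assume y: "y \<in> third u v"
        note y' = third_edges[OF y]
        from y obtain f where f: "f \<in> Phi" "\<delta> f = {{u, v}, {v, y}, {u, y}}"
          unfolding third_def by blast
        have "f \<in> ?T"
          unfolding mem_Collect_eq f(2) using f(1) y'(7-9) by (simp add: card_insert_if doubleton_eq_iff)
        moreover have "t f = y"
        proof -
          have "{v, t f} \<in> \<delta> f" "{u, t f} \<in> \<delta> f"
            using t[OF \<open>f \<in> ?T\<close>] by simp_all
          then have "{v, t f} \<in> {{u, v}, {v, y}, {u, y}}" "{u, t f} \<in> {{u, v}, {v, y}, {u, y}}"
            unfolding f(2) .
          then show ?thesis using y' assms by (auto simp: doubleton_eq_iff)
        qed
        ultimately show "y \<in> t ` ?T" by blast
      qed
    qed
  qed
  then show ?thesis unfolding \<tau>_def by (rule bij_betw_same_card)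
qed

lemma \<tau>_split:
  assumes "e \<in> X"
  shows "card {f \<in> Phi. e \<in> \<delta> f \<and> card (\<delta> f) \<noteq> 3} + \<tau> e = 2"
proof -
  have "{f \<in> Phi. e \<in> \<delta> f} = {f \<in> Phi. e \<in> \<delta> f \<and> card (\<delta> f) \<noteq> 3} \<union> {f \<in> Phi. e \<in> \<delta> f \<and> card (\<delta> f) = 3}"
    by blast
  then show ?thesis
    unfolding \<tau>_def \<delta>_two[OF assms, symmetric] using finite_Phi
    by (subst card_Un_disjoint[symmetric]) auto
qed

lemma \<tau>_le_2: "\<tau> e \<le> 2"
proof (cases "e \<in> X")
  case True
  then show ?thesis using \<tau>_split by (metis le_add2)
next
  case False
  then have none: "{f \<in> Phi. e \<in> \<delta> f \<and> card (\<delta> f) = 3} = {}" using \<delta>_sub by blast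
  show ?thesis unfolding \<tau>_def none by simp
qed

lemma \<tau>_le_1: "f \<in> Phi \<Longrightarrow> e \<in> \<delta> f \<Longrightarrow> card (\<delta> f) \<noteq> 3 \<Longrightarrow> \<tau> e \<le> 1"
proof -
  assume f: "f \<in> Phi" "e \<in> \<delta> f" "card (\<delta> f) \<noteq> 3"
  then have "card {f \<in> Phi. e \<in> \<delta> f \<and> card (\<delta> f) \<noteq> 3} \<noteq> 0"
    using finite_Phi by auto
  then show ?thesis using \<tau>_split[of e] f \<delta>_sub by fastforce
qed

lemma edge_degree:
  assumes "w \<in> N v"
  shows "8 + 2 * \<tau> {v, w} \<le> d v + d w"
proof -
  have vw: "v \<noteq> w" "v \<in> V" "w \<in> V" using assms adj by (auto simp: N_def)
  have "card (third v w) \<le> card (N v \<inter> N w)"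
    using third_edges(4,5) finite_N by (intro card_mono) auto
  then show ?thesis
    using degree_sum[of v w] vw assms \<tau>_third[OF vw(1)] by simp
qed

text \<open>
  Initial charges: \<open>d v - 6\<close> at a vertex, \<open>2 * n - 6\<close> at a face with \<open>n\<close> border edges, \<open>4\<close> at an edge
  outside \<open>X\<close>. By Euler's formula they sum to at most \<open>- 12\<close>. For each of its border edges \<open>e\<close>, a
  non-triangular face gives \<open>side v e\<close> to each end \<open>v\<close> of \<open>e\<close>, an edge outside \<open>X\<close> gives \<open>2\<close> to each end,
  and a vertex \<open>w\<close> gives \<open>send v w\<close> to its neighbour \<open>v\<close>. Thus \<open>share v e\<close> is what \<open>v\<close> gets along \<open>e\<close> from
  the faces, or from \<open>e\<close> itself. A vertex of degree \<open>k \<le> 5\<close> needs \<open>6 - k\<close>: for \<open>k = 3, 4\<close> each of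
  its edges yields \<open>(6 - k) / k\<close>. Afterwards only a vertex of degree at most \<open>2\<close>, and there is at most
  one, has negative charge, at least \<open>- 6\<close>.
\<close>

definition side :: "'a \<Rightarrow> 'a set \<Rightarrow> real" where
  "side v e = (if d v = 3 then (if \<tau> e = 1 then 1 else 1/2)
     else if d v = 4 then (if \<tau> e = 1 then 1/2 else 1/4)
     else if d v = 5 then 1/4 else 0)"

text \<open>At degree 5 each non-triangular side of an edge pays \<open>1/4\<close>, together at
  least \<open>(10 - T v) / 4\<close>. This can miss the needed \<open>1\<close> only if
  \<open>T v \<ge> 7\<close>, the threshold in \<open>send\<close>; the \<open>1/5\<close> there is
  the need divided among five edges.\<close>

definition T :: "'a \<Rightarrow> nat" where "T v = (\<Sum>w\<in>N v. \<tau> {v, w})"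

definition send :: "'a \<Rightarrow> 'a \<Rightarrow> real" where
  "send v w = (if \<tau> {v, w} \<noteq> 2 then 0 else if d v = 3 then 1 else if d v = 4 then 1/2
     else if d v = 5 \<and> 7 \<le> T v then 1/5 else 0)"

definition share :: "'a \<Rightarrow> 'a set \<Rightarrow> real" where
  "share v e = (if e \<in> X then (2 - real (\<tau> e)) * side v e else 2)"

section \<open>What faces and bridges give\<close>

lemma side_nonneg: "0 \<le> side v e" and send_nonneg: "0 \<le> send v w"
  by (simp_all add: side_def send_def)

lemma share_nonneg: "0 \<le> share v e"
  using \<tau>_le_2[of e] side_nonneg by (simp add: share_def)

lemma side_bounds:
  "side v e \<le> 1" "d v \<noteq> 3 \<Longrightarrow> side v e \<le> 1/2" "5 \<le> d v \<Longrightarrow> side v e \<le> 1/4"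
  "6 \<le> d v \<Longrightarrow> side v e = 0" "\<tau> e \<noteq> 1 \<Longrightarrow> side v e \<le> 1/2" "\<tau> e \<noteq> 1 \<Longrightarrow> d v \<noteq> 3 \<Longrightarrow> side v e \<le> 1/4"
  by (auto simp: side_def)

text \<open>If the other side of the edge is a triangle, the degrees sum to at least 10: one end has
  degree at least 6 and takes nothing, or both have degree 5. Otherwise the sum is at least 8 and
  the lower rates of \<open>side\<close> apply.\<close>

lemma edge_sides_le:
  assumes f: "f \<in> Phi" "{a, b} \<in> \<delta> f" "card (\<delta> f) \<noteq> 3"
  shows "side a {a, b} + side b {a, b} \<le> (if d a = 3 \<or> d b = 3 then 1 else 1/2)"
proof -
  have t: "\<tau> {a, b} \<le> 1" using \<tau>_le_1[OF f] .
  have ab: "8 + 2 * \<tau> {a, b} \<le> d a + d b"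
    using edge_degree[of b a] \<delta>_edge[OF f(1,2)] by (simp add: N_def)
  show ?thesis
  proof (cases "\<tau> {a, b} = 1")
    case True
    then have "10 \<le> d a + d b" using ab by simp
    then have "d a \<ge> 6 \<or> d b \<ge> 6 \<or> d a = 5 \<and> d b = 5" by linarith
    then show ?thesis
      using side_bounds(1-4)[of a "{a, b}"] side_bounds(1-4)[of b "{a, b}"] by auto
  next
    case False
    have ab: "8 \<le> d a + d b" using ab by simp
    show ?thesis
      using ab False side_bounds(3)[of a "{a, b}"] side_bounds(3)[of b "{a, b}"]
        side_bounds(5,6)[of "{a, b}" a] side_bounds(5,6)[of "{a, b}" b]
      by (cases "d a = 3"; cases "d b = 3") auto
  qed
qed

definition total :: "'a set \<Rightarrow> real" where "total e = (\<Sum>v\<in>e. side v e)"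

lemma total_pair: "a \<noteq> b \<Longrightarrow> total {a, b} = side a {a, b} + side b {a, b}"
  by (simp add: total_def)

lemma total_le:
  assumes f: "f \<in> Phi" "e \<in> \<delta> f" "card (\<delta> f) \<noteq> 3"
  shows "total e \<le> (if \<exists>v\<in>e. d v = 3 then 1 else 1/2)"
proof -
  obtain a b where "e = {a, b}" "a \<noteq> b"
    using edge_ex[OF \<delta>_edge[OF f(1,2)]] by blast
  then show ?thesis
    using edge_sides_le[of f a b] f by (simp add: total_pair)
qed

lemma three_neighbours:
  assumes "d v = 3" "w \<in> N v"
  shows "5 \<le> d w" "x \<in> N w \<Longrightarrow> x \<noteq> v \<Longrightarrow> 5 \<le> d x"
proof -
  show "5 \<le> d w" using edge_degree[OF assms(2)] assms(1) by simp
  assume "x \<in> N w" "x \<noteq> v"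
  then show "5 \<le> d x"
    using share_degree[of x v w] assms N_sym[of x w] by (simp split: if_splits)
qed

text \<open>Each edge of \<open>S\<close> is mapped to its end \<open>w\<close> other than the
  vertex of degree 3. This is injective, as no vertex has two neighbours of degree 3, and the next
  border edge at \<open>w\<close> is outside \<open>S\<close>. So the edges outside
  \<open>S\<close>, with two ends each, cover all these vertices.\<close>

lemma few_three_edges:
  assumes f: "f \<in> Phi"
  defines "S \<equiv> {e \<in> \<delta> f. \<exists>v\<in>e. d v = 3}"
  shows "card S \<le> 2 * card (\<delta> f - S)"
proof -
  have "\<exists>w v. e = {w, v} \<and> d v = 3 \<and> w \<in> N v" if e: "e \<in> S" for e
  proof -
    obtain v where v: "v \<in> e" "d v = 3" and "e \<in> \<delta> f" using e by (auto simp: S_def)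
    moreover obtain a b where ab: "e = {a, b}" using edge_ex \<delta>_edge[OF f \<open>e \<in> \<delta> f\<close>] by blast
    ultimately have "e = {a, v} \<or> e = {b, v}" by auto
    then obtain w where w: "e = {w, v}" by blast
    then have "w \<in> N v" using \<delta>_edge[OF f \<open>e \<in> \<delta> f\<close>] by (simp add: N_def insert_commute)
    then show ?thesis using w v by blast
  qed
  then have "\<exists>g. \<forall>e\<in>S. \<exists>v. e = {g e, v} \<and> d v = 3 \<and> g e \<in> N v"
    by (intro bchoice) blast
  then obtain g where g: "\<And>e. e \<in> S \<Longrightarrow> \<exists>v. e = {g e, v} \<and> d v = 3 \<and> g e \<in> N v"
    by blast
  have fin: "finite (\<delta> f)" by (rule finite_\<delta>[OF f])
  have "inj_on g S"
  proof (rule inj_onI)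
    fix e e' assume e: "e \<in> S" "e' \<in> S" "g e = g e'"
    obtain v where v: "e = {g e, v}" "d v = 3" "g e \<in> N v" using g[OF e(1)] by blast
    obtain v' where v': "e' = {g e', v'}" "d v' = 3" "g e' \<in> N v'" using g[OF e(2)] by blast
    have "v = v'"
    proof (rule ccontr)
      assume "v \<noteq> v'"
      then have "5 \<le> d v'" using three_neighbours(2)[OF v(2,3), of v'] v'(3) e(3) N_sym[of "g e'" v'] by simp
      then show False using v'(2) by simp
    qed
    then show "e = e'" using v v' e(3) by simp
  qed
  moreover have "g ` S \<subseteq> \<Union>(\<delta> f - S)"
  proof
    fix w assume "w \<in> g ` S"
    then obtain e v where v: "e \<in> S" "e = {w, v}" "d v = 3" "w \<in> N v" using g by blast
    then have "{w, v} \<in> \<delta> f" by (simp add: S_def)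
    then obtain z where z: "{w, z} \<in> \<delta> f" "z \<noteq> v" "z \<in> N w" using next_edge[OF f] by metis
    have "5 \<le> d w" "5 \<le> d z"
      using three_neighbours[OF v(3,4)] z by blast+
    then have "{w, z} \<notin> S" by (auto simp: S_def)
    then show "w \<in> \<Union>(\<delta> f - S)" using z by blast
  qed
  moreover have "finite (\<Union>(\<delta> f - S))"
    using fin card_edge \<delta>_edge[OF f] by (metis DiffE card.infinite finite_Diff finite_Union zero_neq_numeral)
  ultimately have "card S \<le> card (\<Union>(\<delta> f - S))"
    by (metis card_image card_mono)
  also have "\<dots> \<le> (\<Sum>e\<in>\<delta> f - S. card e)"
    by (rule card_Union_le_sum_card)
  also have "\<dots> = (\<Sum>e\<in>\<delta> f - S. 2)"
    by (intro sum.cong refl) (use card_edge \<delta>_edge[OF f] in blast)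
  finally show ?thesis by simp
qed

text \<open>The border is the cycle \<open>v x q y\<close>. The opposite vertex \<open>q\<close> has
  the two common neighbours \<open>x\<close> and \<open>y\<close> with \<open>v\<close>, which
  forces its degree up to 7.\<close>

lemma four_cycle_with_three:
  assumes f: "f \<in> Phi" "card (\<delta> f) = 4" and v: "{v, x} \<in> \<delta> f" "d v = 3"
  obtains y q where "\<delta> f = {{v, x}, {v, y}, {x, q}, {y, q}}" "card {v, x, y, q} = 4" "7 \<le> d q"
proof -
  note E = \<delta>_edge[OF f(1)]
  note fin = finite_\<delta>[OF f(1)]
  have vx: "v \<noteq> x" using adj E v(1) by blast
  obtain y where y: "{v, y} \<in> \<delta> f" "y \<noteq> x" "y \<noteq> v" using next_edge[OF f(1) v(1)] by metis
  obtain q where q: "{x, q} \<in> \<delta> f" "q \<noteq> v" "q \<noteq> x"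
    using next_edge[of f x v] f(1) v(1) by (metis insert_commute)
  obtain r where r: "{y, r} \<in> \<delta> f" "r \<noteq> v" "r \<noteq> y"
    using next_edge[of f y v] f(1) y(1) by (metis insert_commute)
  \<comment> \<open>Otherwise three border edges form a triangle; the fourth has no dead end, so
    both its ends lie on the triangle and it is one of the three.\<close>
  have "q \<noteq> y"
  proof
    assume qy: "q = y"
    let ?A = "{{v, x}, {v, y}, {x, y}}"
    have "card ?A = 3" using vx y by (simp add: card_insert_if doubleton_eq_iff)
    moreover have A: "?A \<subseteq> \<delta> f" using v y q qy by simp
    ultimately have "card (\<delta> f - ?A) = 1" using f(2) card_Diff_subset[of ?A "\<delta> f"] by simp
    then obtain e where e: "\<delta> f - ?A = {e}" by (auto simp: card_1_singleton_iff)
    then have ef: "e \<in> \<delta> f" "e \<notin> ?A" by blast+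
    obtain a b where ab: "e = {a, b}" "a \<noteq> b" using edge_ex[OF E[OF ef(1)]] by blast
    have in3: "c \<in> {v, x, y}" if c: "c \<in> e" for c
    proof -
      obtain e' where "e' \<in> \<delta> f" "e' \<noteq> e" "c \<in> e'" using \<delta>_min_degree[OF f(1) ef(1) c] by blast
      then have "e' \<in> ?A" using e by blast
      then show ?thesis using \<open>c \<in> e'\<close> by blast
    qed
    have "a \<in> {v, x, y}" "b \<in> {v, x, y}" using in3 ab by blast+
    then have "e \<in> ?A" using ab by auto
    then show False using ef by blast
  qed
  have card4: "card {{v, x}, {v, y}, {x, q}, {y, r}} = 4"
    using vx y q r \<open>q \<noteq> y\<close> by (simp add: card_insert_if doubleton_eq_iff)
  have "{{v, x}, {v, y}, {x, q}, {y, r}} = \<delta> f"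
    using v y q r card4 f(2) by (intro card_subset_eq[OF fin]) simp_all
  note eq = this[symmetric]
  obtain z where z: "{q, z} \<in> \<delta> f" "z \<noteq> x" using next_edge[of f q x] f(1) q(1) by (metis insert_commute)
  then have "q = r"
    using eq q \<open>q \<noteq> y\<close> by (auto simp: doubleton_eq_iff)
  then have eq': "\<delta> f = {{v, x}, {v, y}, {x, q}, {y, q}}" using eq by simp
  have "{v, x} \<in> E" "{v, y} \<in> E" "{x, q} \<in> E" "{y, q} \<in> E" using E eq' by simp_all
  then have "{x, y} \<subseteq> N v \<inter> N q" by (simp add: N_def insert_commute)
  then have "10 \<le> d v + d q" using share_two_degree[of v q x y] q y by simp
  then have "7 \<le> d q" using v by simp
  moreover have "card {v, x, y, q} = 4" using vx y q \<open>q \<noteq> y\<close> by simp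
  ultimately show thesis using that eq' by blast
qed

text \<open>Here \<open>q\<close> takes nothing. If the other side of \<open>{v, x}\<close> is a
  triangle, \<open>x\<close> has degree at least 7 and takes nothing either; otherwise the bound is
  \<open>1/2\<close> for \<open>v\<close> plus \<open>1/4\<close> for \<open>x\<close> on each of
  the two edges.\<close>

lemma two_sides_le:
  assumes f: "f \<in> Phi" "{v, x} \<in> \<delta> f" "{x, q} \<in> \<delta> f" "card (\<delta> f) \<noteq> 3" and v: "d v = 3" and q: "7 \<le> d q"
  shows "total {v, x} + total {x, q} \<le> 1"
proof -
  have vx: "{v, x} \<in> E" "{x, q} \<in> E" using \<delta>_edge f by blast+
  then have ne: "v \<noteq> x" "x \<noteq> q" using adj by blast+
  have deg: "8 + 2 * \<tau> {v, x} \<le> 3 + d x"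
    using edge_degree[of x v] vx v by (simp add: N_def)
  have xq: "total {x, q} = side x {x, q}"
    using ne q side_bounds(4)[of q "{x, q}"] by (simp add: total_pair)
  show ?thesis
  proof (cases "\<tau> {v, x} = 1")
    case True
    then have "7 \<le> d x" using deg by simp
    then have "total {x, q} = 0" using xq side_bounds(4)[of x] by simp
    moreover have "total {v, x} \<le> 1"
      using edge_sides_le[of f v x] f ne by (simp add: total_pair split: if_splits)
    ultimately show ?thesis by simp
  next
    case False
    have "5 \<le> d x" using deg by simp
    then show ?thesis
      using xq ne False side_bounds(3)[of x "{v, x}"] side_bounds(3)[of x "{x, q}"]
        side_bounds(5)[of "{v, x}" v] by (simp add: total_pair)
  qed
qed

text \<open>The bound \<open>total_le\<close> suffices except for \<open>n = 4\<close> with a vertex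
  of degree 3. There the face has only \<open>2\<close> to give, and the two paths from
  \<open>v\<close> to the opposite vertex take at most \<open>1\<close> each.\<close>

lemma face_supply:
  assumes f: "f \<in> Phi" "card (\<delta> f) \<noteq> 3"
  shows "(\<Sum>e\<in>\<delta> f. total e) \<le> 2 * real (card (\<delta> f)) - 6"
proof -
  let ?n = "card (\<delta> f)"
  define S where "S = {e \<in> \<delta> f. \<exists>v\<in>e. d v = 3}"
  note fin = finite_\<delta>[OF f(1)]
  have "(\<Sum>e\<in>\<delta> f. total e) \<le> (\<Sum>e\<in>\<delta> f. 1/2 + (if e \<in> S then 1/2 else 0))"
    using total_le[OF f(1) _ f(2)] by (intro sum_mono) (fastforce simp: S_def split: if_splits)
  also have "\<dots> = real ?n / 2 + real (card S) / 2"
    using fin by (simp add: sum.distrib sum.If_cases S_def Int_def conj_commute)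
  finally have le: "(\<Sum>e\<in>\<delta> f. total e) \<le> real ?n / 2 + real (card S) / 2" .
  have S: "S \<subseteq> \<delta> f" by (auto simp: S_def)
  have "card (\<delta> f - S) = ?n - card S" "card S \<le> ?n"
    using S fin by (simp_all add: card_Diff_subset finite_subset card_mono)
  then have S3: "3 * card S \<le> 2 * ?n" "card S \<le> ?n"
    using few_three_edges[OF f(1)] unfolding S_def by simp_all
  have n4: "4 \<le> ?n" using border_ge_3[OF f(1)] f(2) by simp
  show ?thesis
  proof (cases "?n = 4 \<and> S \<noteq> {}")
    case True
    then obtain e v where e: "e \<in> \<delta> f" "v \<in> e" "d v = 3" by (auto simp: S_def)
    then obtain x where "e = {v, x}"
      using edge_ex[OF \<delta>_edge[OF f(1) e(1)]] by (metis doubleton_eq_iff insertE singletonD)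
    then obtain y q where *: "\<delta> f = {{v, x}, {v, y}, {x, q}, {y, q}}" "card {v, x, y, q} = 4" "7 \<le> d q"
      using four_cycle_with_three[OF f(1), of v x] True e by metis
    have ne: "v \<noteq> x" "v \<noteq> y" "v \<noteq> q" "x \<noteq> y" "x \<noteq> q" "y \<noteq> q"
      using *(2) by (auto simp: card_insert_if split: if_splits)
    have "(\<Sum>e\<in>\<delta> f. total e) = total {v, x} + total {x, q} + (total {v, y} + total {y, q})"
      unfolding *(1) using ne by (simp add: doubleton_eq_iff)
    also have "\<dots> \<le> 1 + 1"
      using *(1,3) e(3) by (intro add_mono two_sides_le[OF f(1) _ _ f(2)]) simp_all
    finally show ?thesis using True by simp
  next
    case False
    then consider "?n = 4" "card S = 0" | "5 \<le> ?n"
      using n4 by fastforce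
    then show ?thesis
    proof cases
      case 2
      \<comment> \<open>Integrality matters: for five edges, \<open>3 * card S \<le> 10\<close>
        gives \<open>card S \<le> 3\<close>, exactly what is needed.\<close>
      then have "?n + card S + 12 \<le> 4 * ?n" using S3 by linarith
      then show ?thesis using le by linarith
    qed (use le in simp)
  qed
qed

text \<open>What vertices get along edges is regrouped by donor. Triangles give nothing and have
  charge \<open>0\<close>. Bridges add \<open>4 * card (E - X)\<close>, so \<open>card X\<close>
  cancels.\<close>

lemma supply_total:
  "(\<Sum>v\<in>V. \<Sum>w\<in>N v. share v {v, w}) \<le> 4 * real (card E) - 6 * real (card Phi)"
proof -
  have "(\<Sum>v\<in>V. \<Sum>w\<in>N v. share v {v, w}) = (\<Sum>e\<in>E. \<Sum>v\<in>e. share v e)"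
    by (rule handshake)
  also have "\<dots> = (\<Sum>e\<in>E - X. \<Sum>v\<in>e. share v e) + (\<Sum>e\<in>X. \<Sum>v\<in>e. share v e)"
    by (rule sum.subset_diff[OF X_sub finite_E])
  also have "(\<Sum>e\<in>E - X. \<Sum>v\<in>e. share v e) = (\<Sum>e\<in>E - X. 4)"
    by (intro sum.cong refl) (simp add: share_def card_edge)
  also have "(\<Sum>e\<in>X. \<Sum>v\<in>e. share v e) = (\<Sum>e\<in>X. \<Sum>f\<in>{f \<in> Phi. e \<in> \<delta> f \<and> card (\<delta> f) \<noteq> 3}. total e)"
  proof (rule sum.cong[OF refl])
    fix e assume e: "e \<in> X"
    have "real (card {f \<in> Phi. e \<in> \<delta> f \<and> card (\<delta> f) \<noteq> 3}) = 2 - real (\<tau> e)"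
      using \<tau>_split[OF e] by linarith
    then show "(\<Sum>v\<in>e. share v e) = (\<Sum>f\<in>{f \<in> Phi. e \<in> \<delta> f \<and> card (\<delta> f) \<noteq> 3}. total e)"
      using e by (simp add: share_def total_def sum_distrib_left)
  qed
  also have "\<dots> = (\<Sum>e\<in>X. \<Sum>f\<in>{f \<in> Phi. e \<in> \<delta> f}. if card (\<delta> f) \<noteq> 3 then total e else 0)"
  proof (rule sum.cong[OF refl])
    fix e
    have "{f \<in> Phi. e \<in> \<delta> f \<and> card (\<delta> f) \<noteq> 3} = {f \<in> {f \<in> Phi. e \<in> \<delta> f}. card (\<delta> f) \<noteq> 3}"
      by blast
    then show "(\<Sum>f\<in>{f \<in> Phi. e \<in> \<delta> f \<and> card (\<delta> f) \<noteq> 3}. total e) =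
      (\<Sum>f\<in>{f \<in> Phi. e \<in> \<delta> f}. if card (\<delta> f) \<noteq> 3 then total e else 0)"
      using sum.inter_filter[of "{f \<in> Phi. e \<in> \<delta> f}" "\<lambda>_. total e" "\<lambda>f. card (\<delta> f) \<noteq> 3"] finite_Phi
      by simp
  qed
  also have "\<dots> = (\<Sum>f\<in>Phi. \<Sum>e\<in>{e \<in> X. e \<in> \<delta> f}. if card (\<delta> f) \<noteq> 3 then total e else 0)"
    by (rule sum.swap_restrict[OF finite_X finite_Phi])
  also have "\<dots> \<le> (\<Sum>f\<in>Phi. 2 * real (card (\<delta> f)) - 6)"
  proof (rule sum_mono)
    fix f assume f: "f \<in> Phi"
    then have "{e \<in> X. e \<in> \<delta> f} = \<delta> f" using \<delta>_sub by blast
    then show "(\<Sum>e\<in>{e \<in> X. e \<in> \<delta> f}. if card (\<delta> f) \<noteq> 3 then total e else 0) \<le> 2 * real (card (\<delta> f)) - 6"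
      using face_supply[OF f] by (cases "card (\<delta> f) = 3") auto
  qed
  also have "\<dots> = 4 * real (card X) - 6 * real (card Phi)"
    using border_total by (simp add: sum_subtractf flip: sum_distrib_left)
  also have "(\<Sum>e\<in>E - X. 4) = 4 * real (card E) - 4 * real (card X)"
    using X_sub finite_X card_mono[OF finite_E X_sub] by (simp add: card_Diff_subset of_nat_diff)
  finally show ?thesis by simp
qed

section \<open>What vertices give to their neighbours\<close>

lemma send_pos:
  assumes "send x v > 0" "x \<in> N v"
  shows "\<tau> {v, x} = 2" "d x \<in> {3, 4, 5}" "12 \<le> d x + d v" "d x = 5 \<Longrightarrow> 7 \<le> T x"
proof -
  show *: "\<tau> {v, x} = 2" "d x \<in> {3, 4, 5}" "d x = 5 \<Longrightarrow> 7 \<le> T x"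
    using assms(1) by (auto simp: send_def insert_commute split: if_splits)
  show "12 \<le> d x + d v"
    using edge_degree[OF assms(2)] *(1) by simp
qed

lemma third_degree:
  assumes "y \<in> third v x"
  shows "10 \<le> d x + d y"
proof -
  note y = third_edges[OF assms]
  have "y \<in> N x" "v \<in> N x" "v \<in> N y" using y N_sym by blast+
  then show ?thesis using share_degree[of x y v] y by simp
qed

text \<open>Since \<open>{x, y}\<close> and \<open>{x, z}\<close> have at most one triangle each,
  the other two neighbours of \<open>x\<close> contribute at least \<open>7 - 2 - 1 - 1 = 3\<close>
  to \<open>T x\<close>, so one of them, \<open>p\<close>, has two triangles on its edge. The apex
  of one of these is \<open>v\<close>, \<open>y\<close> or \<open>z\<close>: \<open>v\<close> would
  have \<open>p\<close> as a third apex, and \<open>y\<close> or \<open>z\<close> would get a second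
  triangle.\<close>

lemma not_both_thirds_5:
  assumes x: "d x = 5" "7 \<le> T x" and third: "third v x = {y, z}" "y \<noteq> z" and 5: "d y = 5" "d z = 5"
  shows False
proof -
  have y: "y \<in> third v x" and z: "z \<in> third v x" using third by simp_all
  note y' = third_edges[OF y] and z' = third_edges[OF z]
  have Nx: "v \<in> N x" "y \<in> N x" "z \<in> N x"
    using y' z' N_sym by blast+
  have \<tau>y: "\<tau> {x, y} \<le> 1" using edge_degree[OF Nx(2)] x 5 by simp
  have \<tau>z: "\<tau> {x, z} \<le> 1" using edge_degree[OF Nx(3)] x 5 by simp
  let ?R = "N x - {v, y, z}"
  have vyz: "card {v, y, z} = 3" using y' z' third(2) by auto
  have R2: "card ?R = 2"
    using Nx vyz x(1) by (simp add: card_Diff_subset d_def)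
  have "T x = (\<Sum>w\<in>?R. \<tau> {x, w}) + (\<Sum>w\<in>{v, y, z}. \<tau> {x, w})"
    unfolding T_def using Nx by (intro sum.subset_diff finite_N) simp
  also have "(\<Sum>w\<in>{v, y, z}. \<tau> {x, w}) = \<tau> {x, v} + \<tau> {x, y} + \<tau> {x, z}"
    using y' z' third(2) by auto
  finally have R3: "3 \<le> (\<Sum>w\<in>?R. \<tau> {x, w})"
    using x(2) \<tau>y \<tau>z \<tau>_le_2[of "{x, v}"] by linarith
  have "\<exists>p\<in>?R. \<tau> {x, p} = 2"
  proof (rule ccontr)
    assume *: "\<not> (\<exists>p\<in>?R. \<tau> {x, p} = 2)"
    have "\<tau> {x, p} \<le> 1" if p: "p \<in> ?R" for p
      using * \<tau>_le_2[of "{x, p}"] p by force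
    then have "(\<Sum>w\<in>?R. \<tau> {x, w}) \<le> (\<Sum>w\<in>?R. 1)" by (intro sum_mono)
    then show False using R2 R3 by simp
  qed
  then obtain p where p: "p \<in> ?R" "\<tau> {x, p} = 2" by blast
  then have px: "x \<noteq> p" using N_irrefl by blast
  then have p2: "card (third x p) = 2" using \<tau>_third p(2) by simp
  have "card (?R - {p}) = 1" using p(1) R2 by simp
  then obtain q where q: "?R - {p} = {q}" by (auto simp: card_1_singleton_iff)
  have "\<not> third x p \<subseteq> {q}"
    using p2 card_mono[of "{q}" "third x p"] by auto
  then obtain s where s: "s \<in> third x p" "s \<noteq> q" by blast
  have "s \<in> N x" "s \<noteq> p" using third_edges[OF s(1)] by blast+
  then have "s \<in> {v, y, z}" using s(2) q by blast
  moreover have "p \<in> third x s" using s(1) third_perm(1) by blast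
  moreover have "p \<notin> third x v"
    using third(1) p(1) third_perm(2)[of p x v] by blast
  moreover have "p \<notin> third x y" if \<tau>': "\<tau> {x, y} \<le> 1" "y \<in> third v x" for y
  proof
    assume py: "p \<in> third x y"
    have "v \<in> third x y" using \<tau>'(2) third_perm by blast
    moreover have "x \<noteq> y" "v \<noteq> p" using third_edges[OF py] p(1) by blast+
    ultimately have "card {p, v} \<le> card (third x y)"
      using py finite_third by (intro card_mono) auto
    then show False using \<tau>'(1) \<tau>_third[OF \<open>x \<noteq> y\<close>] \<open>v \<noteq> p\<close> by simp
  qed
  ultimately show False using \<tau>y \<tau>z y z by blast
qed

text \<open>Count pairs of a receiver \<open>x\<close> in \<open>D\<close> and an apex
  \<open>y\<close> outside \<open>D\<close> of a triangle on \<open>{v, x}\<close>. For degree 4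
  both apexes have degree at least 6, hence are not in \<open>D\<close>; for degree 5 at least one
  is not. Each \<open>y\<close> serves at most two receivers, as \<open>{v, y}\<close> has at most
  two triangles.\<close>

lemma demand_bound:
  assumes v: "v \<in> V" and no3: "\<And>x. x \<in> N v \<Longrightarrow> send x v > 0 \<Longrightarrow> d x \<noteq> 3"
  defines "D \<equiv> {x \<in> N v. send x v > 0}"
  shows "2 * card {x \<in> D. d x = 4} + card {x \<in> D. d x = 5} \<le> 2 * card (N v - D)"
proof -
  let ?B = "N v - D"
  have fin: "finite D" "finite ?B" using finite_N by (simp_all add: D_def)
  have D: "x \<in> N v" "x \<noteq> v" "card (third v x) = 2" "d x = 4 \<or> d x = 5" "d x = 5 \<Longrightarrow> 7 \<le> T x"
    if x: "x \<in> D" for x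
  proof -
    show xN: "x \<in> N v" using x by (simp add: D_def)
    then show "x \<noteq> v" using N_irrefl by blast
    then show "card (third v x) = 2"
      using send_pos(1)[of x v] x \<tau>_third[of v x] by (simp add: D_def)
    show "d x = 4 \<or> d x = 5" "d x = 5 \<Longrightarrow> 7 \<le> T x"
      using send_pos(2,4)[of x v] no3[of x] x by (auto simp: D_def)
  qed
  have lower: "(if d x = 4 then 2 else 1) \<le> card {y \<in> ?B. y \<in> third v x}" if x: "x \<in> D" for x
  proof -
    have sub: "third v x \<subseteq> N v" using third_edges(4) by blast
    show ?thesis
    proof (cases "d x = 4")
      case True
      have "y \<notin> D" if y: "y \<in> third v x" for y
        using third_degree[OF y] True D(4)[of y] by auto
      then have "{y \<in> ?B. y \<in> third v x} = third v x" using sub by blast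
      then show ?thesis using D(3)[OF x] by simp
    next
      case False
      then have d5: "d x = 5" using D(4)[OF x] by simp
      obtain y z where yz: "third v x = {y, z}" "y \<noteq> z"
        using D(3)[OF x] by (auto simp: card_2_iff)
      have "y \<notin> D \<or> z \<notin> D"
      proof (rule ccontr)
        assume "\<not> (y \<notin> D \<or> z \<notin> D)"
        then have "d y = 5" "d z = 5"
          using third_degree[of y v x] third_degree[of z v x] yz d5 D(4)[of y] D(4)[of z] by auto
        then show False
          using not_both_thirds_5[OF d5 D(5)[OF x d5] yz] by blast
      qed
      then have "{y \<in> ?B. y \<in> third v x} \<noteq> {}" using yz sub by blast
      then show ?thesis using False fin by (simp add: Suc_le_eq card_gt_0_iff)
    qed
  qed
  have upper: "card {x \<in> D. y \<in> third v x} \<le> 2" if y: "y \<in> ?B" for y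
  proof -
    have "{x \<in> D. y \<in> third v x} \<subseteq> third v y" using third_perm by blast
    then have "card {x \<in> D. y \<in> third v x} \<le> card (third v y)" using finite_third card_mono by blast
    also have "\<dots> \<le> 2"
      using \<tau>_third[of v y] \<tau>_le_2[of "{v, y}"] y N_irrefl by (metis DiffD1)
    finally show ?thesis .
  qed
  have "2 * card {x \<in> D. d x = 4} + card {x \<in> D. d x = 5} = (\<Sum>x\<in>D. if d x = 4 then 2 else 1)"
  proof -
    have "{x \<in> D. d x = 5} = {x \<in> D. d x \<noteq> 4}" using D(4) by force
    then show ?thesis
      using fin by (simp add: sum.If_cases Int_def conj_commute)
  qed
  also have "\<dots> \<le> (\<Sum>x\<in>D. card {y \<in> ?B. y \<in> third v x})"
    using lower by (intro sum_mono) simp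
  also have "\<dots> = (\<Sum>x\<in>D. \<Sum>y\<in>{y \<in> ?B. y \<in> third v x}. 1)" by simp
  also have "\<dots> = (\<Sum>y\<in>?B. \<Sum>x\<in>{x \<in> D. y \<in> third v x}. 1)"
    by (rule sum.swap_restrict[OF fin])
  also have "\<dots> \<le> (\<Sum>y\<in>?B. 2)"
    using upper by (intro sum_mono) simp
  finally show ?thesis by simp
qed

text \<open>A receiver of degree 3 forces \<open>d v \<ge> 9\<close>, and all other neighbours,
  sharing \<open>v\<close> with it, have degree at least 5 and get at most \<open>1/5\<close>.
  Without one, \<open>demand_bound\<close> applies. At degree at most 6 nothing is given, since
  receiver and donor have degree sum at least 12.\<close>

lemma given_le:
  assumes v: "v \<in> V"
  shows "(\<Sum>x\<in>N v. send x v) \<le> max 0 (real (d v) - 6)"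
proof -
  define D where "D = {x \<in> N v. send x v > 0}"
  have fin: "finite D" using finite_N by (simp add: D_def)
  have sumD: "(\<Sum>x\<in>N v. send x v) = (\<Sum>x\<in>D. send x v)"
    using send_nonneg finite_N by (intro sum.mono_neutral_right) (auto simp: D_def less_le)
  have pos: "x \<in> N v" "\<tau> {v, x} = 2" "d x \<in> {3, 4, 5}" "12 \<le> d x + d v" if x: "x \<in> D" for x
    using send_pos(1-3)[of x v] x by (auto simp: D_def)
  show ?thesis
  proof (cases "\<exists>u\<in>D. d u = 3")
    case True
    then obtain u where u: "u \<in> D" "d u = 3" by blast
    then have dv: "9 \<le> d v" using pos(4)[of u] by simp
    have "send x v \<le> (if x = u then 1 else 1/5)" if x: "x \<in> N v" for x
    proof (cases "x = u")
      case False
      have "v \<in> N x" "v \<in> N u" using x pos(1)[OF u(1)] N_sym by blast+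
      then have "5 \<le> d x" using share_degree[OF False, of v] u(2) by (auto split: if_splits)
      then show ?thesis using False by (simp add: send_def)
    qed (simp add: send_def)
    then have "(\<Sum>x\<in>N v. send x v) \<le> (\<Sum>x\<in>N v. if x = u then 1 else 1/5)"
      by (rule sum_mono)
    also have "\<dots> = 1 + (real (d v) - 1) / 5"
      using pos(1)[OF u(1)] finite_N dv
      by (simp add: sum.If_cases d_def card_Diff_subset Int_absorb1 of_nat_diff flip: Diff_eq)
    also have "\<dots> \<le> real (d v) - 6" using dv by (simp add: field_simps)
    finally show ?thesis by simp
  next
    case False
    let ?D4 = "{x \<in> D. d x = 4}" and ?D5 = "{x \<in> D. d x = 5}"
    have D: "D = ?D4 \<union> ?D5" using False pos(3) by blast
    have "2 * card ?D4 + card ?D5 \<le> 2 * card (N v - D)"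
      unfolding D_def by (rule demand_bound[OF v]) (use False in \<open>auto simp: D_def\<close>)
    moreover have cD: "card D = card ?D4 + card ?D5"
      using fin by (subst D, subst card_Un_disjoint) auto
    moreover have "card D \<le> d v" "card (N v - D) = d v - card D"
      using finite_N fin by (auto simp: d_def D_def card_Diff_subset intro: card_mono)
    ultimately have bound: "4 * card ?D4 + 3 * card ?D5 \<le> 2 * d v" by linarith
    have "(\<Sum>x\<in>D. send x v) \<le> (\<Sum>x\<in>D. 1/5 + (if d x = 4 then 3/10 else 0))"
      using False by (intro sum_mono) (auto simp: send_def)
    also have "\<dots> = real (card D) / 5 + 3/10 * real (card ?D4)"
      using fin by (simp add: sum.distrib sum.If_cases Int_def)
    also have "\<dots> = real (card ?D4) / 2 + real (card ?D5) / 5"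
      unfolding cD by (simp add: field_simps)
    finally have le: "(\<Sum>x\<in>N v. send x v) \<le> real (card ?D4) / 2 + real (card ?D5) / 5"
      using sumD by simp
    show ?thesis
    proof (cases "?D4 = {}")
      case False
      then have "8 \<le> d v" using pos(4) by fastforce
      \<comment> \<open>The gift is at most \<open>(4 * card ?D4 + 3 * card ?D5) / 8\<close>, so at
        most \<open>d v / 4\<close>, which is at most \<open>d v - 6\<close> from degree 8
        on.\<close>
      then show ?thesis using le bound by linarith
    next
      case True
      show ?thesis
      proof (cases "?D5 = {}")
        case False
        then have "7 \<le> d v" using pos(4) by fastforce
        then have "card ?D5 \<le> 5 * d v - 30" using bound True by simp
        then show ?thesis using le True \<open>7 \<le> d v\<close> by simp
      next
        case D5: True
        have "card ?D4 = 0" "card ?D5 = 0" unfolding True D5 by simp_all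
        then show ?thesis using le by simp
      qed
    qed
  qed
qed

section \<open>Final charges\<close>

lemma vertex_charge:
  assumes v: "v \<in> V"
  shows "real (d v) - 6 + (\<Sum>w\<in>N v. share v {v, w}) + (\<Sum>w\<in>N v. send v w) - (\<Sum>w\<in>N v. send w v)
    \<ge> (if d v \<le> 2 then - 6 else 0)"
proof -
  let ?in = "\<Sum>w\<in>N v. share v {v, w} + send v w"
  have nonneg: "0 \<le> ?in"
    by (intro sum_nonneg add_nonneg_nonneg share_nonneg send_nonneg)
  \<comment> \<open>What \<open>v\<close> gives is replaced by its bound from
    \<open>given_le\<close>, so from degree 6 on only the nonnegativity of the income
    matters.\<close>
  have "(if d v \<le> 2 then - 6 else 0) \<le> real (d v) - 6 + ?in - max 0 (real (d v) - 6)"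
  proof -
    consider "d v \<le> 2" | "d v = 3" | "d v = 4" | "d v = 5" | "6 \<le> d v" by linarith
    then show ?thesis
    proof cases
      case 2
      have "1 \<le> share v {v, w} + send v w" for w
        using 2 \<tau>_le_2[of "{v, w}"] by (auto simp: share_def side_def send_def)
      then have "(\<Sum>w\<in>N v. 1) \<le> ?in" by (intro sum_mono)
      then show ?thesis using 2 by (simp add: d_def)
    next
      case 3
      have "1/2 \<le> share v {v, w} + send v w" for w
        using 3 \<tau>_le_2[of "{v, w}"] by (auto simp: share_def side_def send_def)
      then have "(\<Sum>w\<in>N v. 1/2) \<le> ?in" by (intro sum_mono)
      then show ?thesis using 3 by (simp add: d_def)
    next
      case 4
      have T: "real (T v) = (\<Sum>w\<in>N v. real (\<tau> {v, w}))" by (simp add: T_def)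
      have share: "(2 - real (\<tau> {v, w})) / 4 \<le> share v {v, w}" for w
        using 4 \<tau>_le_2[of "{v, w}"] by (auto simp: share_def side_def)
      show ?thesis
      proof (cases "7 \<le> T v")
        case True
        \<comment> \<open>This is the line through the guaranteed \<open>1/4\<close> for one
          triangle and \<open>1/5\<close> for two; with no triangle the edge yields at least
          \<open>1/2\<close>. The sum over five edges is at least \<open>1\<close> because
          \<open>T v \<le> 10\<close>.\<close>
        have "3/10 - real (\<tau> {v, w}) / 20 \<le> share v {v, w} + send v w" for w
        proof -
          consider "\<tau> {v, w} = 0" | "\<tau> {v, w} = 1" | "\<tau> {v, w} = 2" using \<tau>_le_2[of "{v, w}"] by linarith
          then show ?thesis
            using share[of w] share_nonneg[of v "{v, w}"] 4 True by cases (simp_all add: send_def)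
        qed
        then have "(\<Sum>w\<in>N v. 3/10 - real (\<tau> {v, w}) / 20) \<le> ?in" by (intro sum_mono)
        moreover have "(\<Sum>w\<in>N v. 3/10 - real (\<tau> {v, w}) / 20) = 3/2 - real (T v) / 20"
          using 4 unfolding T by (simp add: sum_subtractf d_def sum_divide_distrib)
        moreover have "T v \<le> (\<Sum>w\<in>N v. 2)" unfolding T_def by (intro sum_mono \<tau>_le_2)
        then have "T v \<le> 10" using 4 by (simp add: d_def)
        then have "real (T v) \<le> 10" by simp
        ultimately show ?thesis using 4 by simp
      next
        case False
        have "(2 - real (\<tau> {v, w})) / 4 \<le> share v {v, w} + send v w" for w
          using share[of w] send_nonneg[of v w] by simp
        then have "(\<Sum>w\<in>N v. (2 - real (\<tau> {v, w})) / 4) \<le> ?in" by (intro sum_mono)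
        moreover have "(\<Sum>w\<in>N v. (2 - real (\<tau> {v, w})) / 4) = 5/2 - real (T v) / 4"
          using 4 unfolding T by (simp add: sum_subtractf d_def flip: sum_divide_distrib)
        moreover have "real (T v) \<le> 6" using False by simp
        ultimately show ?thesis using 4 by simp
      qed
    qed (use nonneg in auto)
  qed
  then show ?thesis using given_le[OF v] by (simp add: sum.distrib)
qed

lemma send_swap: "(\<Sum>v\<in>V. \<Sum>w\<in>N v. send v w) = (\<Sum>v\<in>V. \<Sum>w\<in>N v. send w v)"
proof -
  have N: "N v = {w \<in> V. w \<in> N v}" for v using N_sub by blast
  have "(\<Sum>v\<in>V. \<Sum>w\<in>N v. send v w) = (\<Sum>v\<in>V. \<Sum>w\<in>{w \<in> V. w \<in> N v}. send v w)"
    by (intro sum.cong refl N)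
  also have "\<dots> = (\<Sum>w\<in>V. \<Sum>v\<in>{v \<in> V. w \<in> N v}. send v w)"
    by (rule sum.swap_restrict[OF finite_V finite_V])
  also have "\<dots> = (\<Sum>w\<in>V. \<Sum>v\<in>N w. send v w)"
  proof (intro sum.cong refl)
    fix w show "{v \<in> V. w \<in> N v} = N w" using N[of w] N_sym by blast
  qed
  finally show ?thesis .
qed

text \<open>Charge only moves, so its total stays at most \<open>- 12\<close>; yet at most one
  vertex ends negative, with at least \<open>- 6\<close>.\<close>

lemma inconsistent: False
proof -
  let ?L = "{v \<in> V. d v \<le> 2}"
  have "(\<Sum>v\<in>V. if d v \<le> 2 then - 6 else 0) \<le>
    (\<Sum>v\<in>V. real (d v) - 6 + (\<Sum>w\<in>N v. share v {v, w}) + (\<Sum>w\<in>N v. send v w) - (\<Sum>w\<in>N v. send w v))"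
    by (intro sum_mono vertex_charge)
  also have "\<dots> = (\<Sum>v\<in>V. real (d v)) - 6 * real (card V) + (\<Sum>v\<in>V. \<Sum>w\<in>N v. share v {v, w})"
    using send_swap by (simp add: sum.distrib sum_subtractf)
  also have "\<dots> \<le> 6 * real (card E) - 6 * real (card V) - 6 * real (card Phi)"
    using supply_total degree_total by simp
  also have "(\<Sum>v\<in>V. if d v \<le> 2 then - 6 else 0) = - 6 * real (card ?L)"
    using finite_V by (simp add: sum.If_cases Int_def)
  finally have "6 * real (card V) + 6 * real (card Phi) \<le> 6 * real (card E) + 6 * real (card ?L)" by simp
  moreover have "real (card ?L) \<le> 1" using few_low by simp
  moreover have "real (card E) + 2 \<le> real (card Phi) + real (card V)" using euler by linarith
  ultimately show False by linarith
qed

end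

section \<open>The depth of planar graphs\<close>

definition edges :: "'a pair_pre_digraph \<Rightarrow> 'a set set" where
  "edges F = {{u, v} |u v. (u, v) \<in> parcs F}"

lemma (in pair_graph) arc_sym: "(u, v) \<in> parcs G \<longleftrightarrow> (v, u) \<in> parcs G"
  using arcs_symmetric by blast

lemma (in pair_graph) in_edges: "{u, v} \<in> edges G \<longleftrightarrow> (u, v) \<in> parcs G"
proof
  assume "{u, v} \<in> edges G"
  then obtain a b where "{u, v} = {a, b}" "(a, b) \<in> parcs G" by (auto simp: edges_def)
  then show "(u, v) \<in> parcs G" using arc_sym[of a b] by (auto simp: doubleton_eq_iff)
qed (auto simp: edges_def)

lemma (in pair_graph) edges_pair:
  assumes "e \<in> edges G"
  obtains u v where "e = {u, v}" "(u, v) \<in> parcs G" "u \<in> pverts G" "v \<in> pverts G" "u \<noteq> v"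
proof -
  obtain u v where uv: "e = {u, v}" "(u, v) \<in> parcs G" using assms by (auto simp: edges_def)
  show thesis using that[OF uv in_arcsD1[OF uv(2)] in_arcsD2[OF uv(2)] no_loops'[OF uv(2)]] .
qed

lemma (in pair_graph) swap_automorphism:
  assumes uv: "u \<in> pverts G" "v \<in> pverts G" "u \<noteq> v"
  defines "S \<equiv> ({w. (u, w) \<in> parcs G} - {w. (v, w) \<in> parcs G}) \<union>
      ({w. (v, w) \<in> parcs G} - {w. (u, w) \<in> parcs G}) - {u, v}"
  shows "asymmetric_depth G \<le> card S"
proof -
  define W where "W = pverts G - S"
  define H where "H = \<lparr>pverts = W, parcs = {(a, b) \<in> parcs G. a \<in> W \<and> b \<in> W}\<rparr>"
  define f where "f = id(u := v, v := u)"
  have S: "S \<subseteq> pverts G" using in_arcsD2 by (auto simp: S_def)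
  have uvW: "u \<in> W" "v \<in> W" using uv by (auto simp: W_def S_def)
  have ind: "induced_subgraph (with_proj H) (with_proj G)"
    using wf_digraph_axioms
    by (auto simp: induced_subgraph_def subgraph_def H_def W_def compatible_def wf_digraph_def)
  have same: "(u, w) \<in> parcs G \<longleftrightarrow> (v, w) \<in> parcs G" if "w \<in> W" "w \<noteq> u" "w \<noteq> v" for w
    using that by (auto simp: W_def S_def)
  have irrefl: "(w, w) \<notin> parcs G" for w
    using no_loops' by blast
  have "bij_betw f W W"
    using uvW by (intro bij_betw_byWitness[of _ f]) (auto simp: f_def)
  moreover have "(a, b) \<in> parcs G \<longleftrightarrow> (f a, f b) \<in> parcs G" if "a \<in> W" "b \<in> W" for a b
    using that uv(3) same[of a] same[of b] arc_sym[of u v] arc_sym[of a u] arc_sym[of a v] irrefl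
    by (cases "a = u"; cases "a = v"; cases "b = u"; cases "b = v") (simp_all add: f_def)
  moreover have "f a \<in> W" if "a \<in> W" for a
    using that uvW by (simp add: f_def)
  ultimately have "graph_isomorphism f H H"
    by (simp add: graph_isomorphism_def H_def)
  moreover have "f u \<noteq> u" using uv by (simp add: f_def)
  ultimately have "nontrivial_partial_automorphism G H H f"
    using ind uvW unfolding nontrivial_partial_automorphism_def partial_automorphism_def
    by (auto simp: H_def)
  moreover have finW: "finite W" by (simp add: W_def)
  then have "0 < card W" using uvW by (auto simp: card_gt_0_iff)
  moreover have "card (pverts H) = card W" by (simp add: H_def)
  ultimately have "card W \<in> nontrivial_ranks G"
    unfolding nontrivial_ranks_def by blast
  then have "card W \<le> Max (nontrivial_ranks G)"
    by (intro Max_ge finite_nontrivial_ranks pair_graph_axioms)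
  moreover have "card W = card (pverts G) - card S"
    using S by (simp add: W_def card_Diff_subset finite_subset)
  ultimately show ?thesis unfolding asymmetric_depth_def by linarith
qed

lemma (in pair_graph) plane_arcs_edges:
  assumes "plane_drawing G p \<gamma>"
  shows "plane_arcs (edges G) p \<gamma>"
proof
  have inj: "inj_on p (pverts G)"
    using assms by (simp add: plane_drawing_def)
  have arcs: "Path_Connected.arc (\<gamma> {u, v}) \<and>
      {pathstart (\<gamma> {u, v}), pathfinish (\<gamma> {u, v})} = {p u, p v} \<and>
      path_image (\<gamma> {u, v}) \<inter> p ` pverts G = {p u, p v}" if uv: "(u, v) \<in> parcs G" for u v
    using bspec[OF conjunct1[OF conjunct2[OF assms[unfolded plane_drawing_def]]] uv] by simp
  have meet: "path_image (\<gamma> {u, v}) \<inter> path_image (\<gamma> {x, y}) \<subseteq> p ` pverts G"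
    if uv: "(u, v) \<in> parcs G" and xy: "(x, y) \<in> parcs G" "{u, v} \<noteq> {x, y}" for u v x y
    using bspec[OF conjunct2[OF conjunct2[OF assms[unfolded plane_drawing_def]]] uv] xy by fastforce
  show "finite (edges G)"
  proof (rule finite_subset)
    show "edges G \<subseteq> Pow (pverts G)" using edges_pair by auto
  qed simp
  have "\<Union>(edges G) \<subseteq> pverts G" using edges_pair by auto
  then show "inj_on p (\<Union>(edges G))" using inj by (rule inj_on_subset[rotated])
  fix e assume e: "e \<in> edges G"
  obtain u v where uv: "e = {u, v}" "(u, v) \<in> parcs G" "u \<in> pverts G" "v \<in> pverts G" "u \<noteq> v"
    using edges_pair[OF e] .
  show "\<exists>u v. u \<noteq> v \<and> e = {u, v}" using uv by blast
  show "Path_Connected.arc (\<gamma> e)" "{pathstart (\<gamma> e), pathfinish (\<gamma> e)} = p ` e"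
    using arcs[OF uv(2)] uv(1) by simp_all
  fix e' assume e': "e' \<in> edges G" and ne: "e \<noteq> e'"
  obtain x y where xy: "e' = {x, y}" "(x, y) \<in> parcs G" "x \<in> pverts G" "y \<in> pverts G" "x \<noteq> y"
    using edges_pair[OF e'] .
  have "path_image (\<gamma> e) \<inter> path_image (\<gamma> e') \<subseteq> p ` pverts G"
    using meet[OF uv(2) xy(2)] ne uv(1) xy(1) by simp
  moreover have "path_image (\<gamma> e) \<inter> p ` pverts G = p ` e" "path_image (\<gamma> e') \<inter> p ` pverts G = p ` e'"
    using arcs[OF uv(2)] arcs[OF xy(2)] uv(1) xy(1) by simp_all
  \<comment> \<open>Curves may meet only at vertices, and a vertex on both curves is an end of
    both.\<close>
  ultimately have "path_image (\<gamma> e) \<inter> path_image (\<gamma> e') \<subseteq> p ` e \<inter> p ` e'" by blast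
  also have "\<dots> = p ` (e \<inter> e')"
    using inj uv xy by (intro inj_on_image_Int[symmetric]) auto
  finally show "path_image (\<gamma> e) \<inter> path_image (\<gamma> e') \<subseteq> p ` (e \<inter> e')" .
qed

theorem theorem2:
  fixes F :: "'a pair_pre_digraph"
  assumes "pair_graph F"
    and "planar F"
    and "card (pverts F) \<ge> 2"
  shows "asymmetric_depth F \<le> 5"
proof (rule ccontr)
  assume depth: "\<not> asymmetric_depth F \<le> 5"
  interpret pair_graph F by fact
  obtain p \<gamma> where "plane_drawing F p \<gamma>" using assms(2) by (auto simp: planar_def)
  then interpret plane: plane_arcs "edges F" p \<gamma> by (rule plane_arcs_edges)
  have V: "finite (pverts F)" "\<Union>(edges F) \<subseteq> pverts F" "pverts F \<noteq> {}"
    using edges_pair assms(3) by auto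
  obtain X where X: "X \<subseteq> edges F" "plane.bridgeless X" "1 + card (edges F - X) \<le> class_count (pverts F) X"
    using plane.exists_bridgeless_subgraph[OF V] .
  have finF: "finite (plane.faces X)" using plane.finite_faces[OF X(1,2)] .
  obtain S where S: "S \<subseteq> plane.faces X" "1 + card X + class_count (pverts F) X \<le> card S + card (pverts F)"
    using plane.euler_lower_bound[OF V(1,2) X(1)] by blast
  have "dense_map (pverts F) (edges F) X (plane.faces X) (plane.border X)"
  proof
    show "\<exists>u v. u \<in> pverts F \<and> v \<in> pverts F \<and> u \<noteq> v \<and> e = {u, v}" if "e \<in> edges F" for e
      using edges_pair[OF that] by metis
    show "card {f \<in> plane.faces X. e \<in> plane.border X f} = 2" if "e \<in> X" for e
      using plane.card_faces_of_edge[OF X(1,2) that] .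
    show "\<exists>e'\<in>plane.border X f. e' \<noteq> e \<and> u \<in> e'"
      if "f \<in> plane.faces X" "e \<in> plane.border X f" "u \<in> e" for f e u
      using plane.border_min_degree[OF X(1,2) that] by metis
    show "plane.border X f \<noteq> {}" if "X \<noteq> {}" "f \<in> plane.faces X" for f
      using plane.border_nonempty[OF X(1,2) that] .
    show "plane.border X f = X"
      if "f \<in> plane.faces X" "g \<in> plane.faces X" "f \<noteq> g" "plane.border X f = plane.border X g" for f g
      using plane.equal_borders[OF X(1,2) that] .
    show "card (plane.faces X) \<le> 1" if "X = {}"
      using that plane.faces_empty by simp
    have "card S \<le> card (plane.faces X)" using finF S(1) by (rule card_mono)
    moreover have "card (edges F) = card X + card (edges F - X)"
      using card_Diff_subset[OF finite_subset[OF X(1) plane.finite_edges] X(1)]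
        card_mono[OF plane.finite_edges X(1)] by simp
    \<comment> \<open>One unit comes from Euler's inequality for \<open>X\<close>; the other comes
      from the class count, which exceeds the number of bridges.\<close>
    ultimately show "card (edges F) + 2 \<le> card (plane.faces X) + card (pverts F)"
      using S(2) X(3) by linarith
    show "6 \<le> card (({w. {u, w} \<in> edges F} - {w. {v, w} \<in> edges F}) \<union>
        ({w. {v, w} \<in> edges F} - {w. {u, w} \<in> edges F}) - {u, v})"
      if "u \<in> pverts F" "v \<in> pverts F" "u \<noteq> v" for u v
      using swap_automorphism[OF that] depth by (simp add: in_edges)
    show "plane.border X f \<subseteq> X" for f
      unfolding plane.border_def by (rule Collect_subset)
  qed (fact V(1) X(1) finF assms(3))+
  then show False by (rule dense_map.inconsistent)
qed

end
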